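(* The Top Trading Cycles (TTC) rule can be implemented with a locally strategy-proof mechanism. That is, for every finite set $I$ of agents, each initially owning one object (distinct agents own distinct objects, and all objects are owned), there exists a mechanism (as defined in the context) such that, for any utilities representing the agents' strict preferences, the induced game is locally strategy-proof and there are strategies $(\overline{s}_i)_{i\in I}$ such that, for each $i$, $\overline{s}_i(h)$ is locally dominant at every $h\in H_i^{\ast}(\overline{s}_i)$, and for every profile $\theta$ of strict preferences the allocation resulting from $(\theta,(\overline{s}_i)_{i\in I})$ is the TTC allocation at $\theta$.
   Context: Framework. A finite multistage game has a finite player set $I$. First, nature chooses $\theta$ from a nonempty finite set $\Theta$; then there are exactly $T\ge 1$ stages, and at each stage all players simultaneously choose an action. $A_i$ is the finite action set of player $i$ and $A=\times_{i\in I}A_i$. The set of stage-$1$ histories is $X^1=\Theta$; for $t=2,\dots,T$ the set of stage-$t$ histories is $X^t\subseteq\Theta\times A^{t-1}$; the set of terminal histories is $Z\subseteq\Theta\times A^{T}$. Let $X=\cup_{t=1}^T X^t$; $X\cup Z$ is ordered by the "prefix of" relation $\prec$. Each player $i$ has a partition $H_i$ of $X$ into information sets, each containing only histories of the same stage; $\tau(h)$ is the stage of $h$. At each $h\in H_i$ a nonempty set $A_i^h\subseteq A_i$ of actions is available; the feasible action profiles at a history $x\in X$ are exactly those whose $i$-th component lies in $A_i^h$ for the $h\in H_i$ containing $x$, for all $i$, and each feasible profile extends $x$ to a history of the next stage (or to a terminal history after stage $T$). Perfect recall holds: any two histories in the same information set of $i$ have the same sequence of previous information sets and previous actions of $i$.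 Write $h\prec h'$ (for $h,h'\in H_i$) if some element of $h$ is a prefix of some element of $h'$, and $h\prec z$ if some element of $h$ is a prefix of $z\in Z$. Player $i$ is active at $h$ if $|A_i^h|>1$ (otherwise her only action is a dummy action); $H_i^{\ast}$ is the set of $h\in H_i$ where $i$ is active. Each player $i$ has an outcome function $g_i:Z\to Y_i$ and a payoff function $u_i:Z\to\mathbb{R}$. Strategies. A (reduced) strategy $s_i$ of player $i$ assigns an action in $A_i^h$ to each $h\in H_i$ that can be reached given the actions assigned by $s_i$ to the previous information sets of $i$. $S_i$ is the set of strategies of $i$, and $S_{-i}=\Theta\times(\times_{j\ne i}S_j)$ (nature's move is included). $\zeta(s_i,s_{-i})\in Z$ is the terminal history induced by $(s_i,s_{-i})$. For $h\in H_i$, $S_i(h)$ and $S_{-i}(h)$ are the sets of elements of $S_i$ and $S_{-i}$ that allow $h$ to be reached. For $a_i\in A_i^h$, $S_i(h,a_i)=\{s_i\in S_i(h): s_i(h)=a_i\}$. For $s_{-i}\in S_{-i}(h)$, $Z(h,a_i,s_{-i})=\{\zeta(s_i,s_{-i}): s_i\in S_i(h,a_i)\}$. $H_i^{\ast}(s_i)$ is the set of active information sets of $i$ that can be reached when $i$ plays $s_i$. Local partition. For $h\in H_i^\ast$ and $a_i\in A_i^h$ let $S_{-i}^{a_i,h}=\{s_{-i}\in S_{-i}(h):$ for all $z\in Z(h,a_i,s_{-i})$ there is no $h'\in H_i^{\ast}$ with $h\prec h'\prec z\}$. For $\overline{a}_i,a_i\in A_i^h$ let $S^{\overline{a}_i,a_i}(h)=S_{-i}^{a_i,h}\cap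 S_{-i}^{\overline{a}_i,h}$, $S^{\overline{a}_i}_{a_i}(h)=S_{-i}^{\overline{a}_i,h}\setminus S_{-i}^{a_i,h}$, $S^{a_i}_{\overline{a}_i}(h)=S_{-i}^{a_i,h}\setminus S_{-i}^{\overline{a}_i,h}$, $S_{\overline{a}_i,a_i}(h)=S_{-i}(h)\setminus(S_{-i}^{\overline{a}_i,h}\cup S_{-i}^{a_i,h})$, and let $\mathcal{S}^{\ell}(h,\overline{a}_i,a_i)$ be the collection of these four sets. Mimicking. $\mathcal{H}^{\ast}(h,a_i)$ is the set of first active information sets of $i$ after choosing $a_i$ at $h$ (i.e. those $h'\in H_i^{\ast}$ with $h\prec h'$, reachable after choosing $a_i$ at $h$, with no $h''\in H_i^{\ast}$ such that $h\prec h''\prec h'$). For $\overline{s}_i,s_i\in S_i(h)$ and $\overline{S}_{-i}\subseteq S_{-i}(h)$, $\overline{s}_i$ mimics $s_i$ given $h$ and $\overline{S}_{-i}$ if for every $s_{-i}\in\overline{S}_{-i}$, every $\overline{h}\in\mathcal{H}^{\ast}(h,\overline{s}_i(h))$ and all $\overline{h}',h'\in H_i$ with $\overline{h}\preceq\overline{h}'\prec\zeta(\overline{s}_i,s_{-i})$, $h'\prec\zeta(s_i,s_{-i})$ and $\tau(\overline{h}')=\tau(h')$, we have $\overline{s}_i(\overline{h}')=s_i(h')$. Local dominance. At $h\in H_i^{\ast}$, action $\overline{a}_i$ locally dominates $a_i$ if for each nonempty $\overline{S}_{-i}\in\mathcal{S}^{\ell}(h,\overline{a}_i,a_i)$ and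 each $s_i\in S_i(h,a_i)$ there is $\overline{s}_i\in S_i(h,\overline{a}_i)$ that mimics $s_i$ given $h$ and $\overline{S}_{-i}$ such that: if $\overline{S}_{-i}$ is one of the first three sets, $\min_{s_{-i}\in\overline{S}_{-i}}u_i(\zeta(\overline{s}_i,s_{-i}))\ge\max_{s_{-i}\in\overline{S}_{-i}}u_i(\zeta(s_i,s_{-i}))$; if $\overline{S}_{-i}=S_{\overline{a}_i,a_i}(h)$, $g_i(\zeta(\overline{s}_i,s_{-i}))=g_i(\zeta(s_i,s_{-i}))$ for all $s_{-i}\in\overline{S}_{-i}$. An action is locally dominant at $h$ if it locally dominates every other action in $A_i^h$. A game is locally strategy-proof if each player $i$ has a strategy $\overline{s}_i$ such that $\overline{s}_i(h)$ is locally dominant at every $h\in H_i^{\ast}(\overline{s}_i)$. Object allocation and mechanisms. There are finitely many agents $I$ and equally many objects; each agent initially owns one object. Each agent $i$ has a strict preference ranking $\theta_i$ over all objects, privately known to $i$; $\Theta$ is the set of all profiles $\theta=(\theta_i)_{i\in I}$ of strict rankings. An allocation assigns each agent exactly one object, bijectively. A mechanism is a finite multistage game form with player set $I$ (nature first chooses $\theta\in\Theta$; then, in each of exactly $T\ge 1$ stages, all players simultaneously choose actions from the nonempty finite sets $A_i^h$ available at their information sets $h\in H_i$, with perfect recall; payoffs are not part of the game form) whose rules do not depend on preferences: the set of feasible sequences of action profiles does not depend on $\theta$; at each history player $i$ knows exactly her own $\theta_i$ and the cell of a partition of action-profile sequences (the partition not depending on $\theta$) containing the past play, so that each of her information sets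 is the set of histories with a given $\theta_i$ and past play in a given cell; the available actions depend only on that cell; and each terminal sequence of action profiles (irrespective of $\theta$) is mapped to an allocation. In the induced game, $g_i(z)$ is the object agent $i$ receives at $z$, and $u_i(z)$ is the utility of that object under a utility function on objects representing the strict ranking $\theta_i$. TTC rule. Given $\theta$, iterate: each agent not yet assigned an object points to the owner of her highest-ranked object among the still-available objects (those owned by unassigned agents); at least one cycle (possibly of length one) exists; every agent in a cycle is assigned the object of the agent she points to, and these agents and objects are removed. Repeat until all agents are assigned. The resulting allocation is the TTC allocation at $\theta$. *)

theory Defs
  imports Complex_Main "HOL-Library.FuncSet" "HOL-Library.Sublist" "HOL-Library.Disjoint_Sets"
begin

section \<open>Finite multistage games\<close>

text \<open>The player set is the whole (finite) type \<open>'i\<close>.  A history is a state of nature together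
  with the list of action profiles played so far; a history with \<open>k\<close> profiles has stage
  \<open>k + 1\<close>.\<close>

type_synonym ('i, 'n, 'a) hist = "'n \<times> ('i \<Rightarrow> 'a) list"

text \<open>The field \<open>hists\<close> holds all histories, that is \<open>X \<union> Z\<close>.  The action set
  \<open>A\<^sub>i\<close> is left implicit as the union of the sets \<open>avail G i h\<close>.\<close>

record ('i, 'n, 'a) game_form =
  nature  :: "'n set"
  horizon :: nat
  hists   :: "('i, 'n, 'a) hist set"
  info    :: "'i \<Rightarrow> ('i, 'n, 'a) hist set set"
  avail   :: "'i \<Rightarrow> ('i, 'n, 'a) hist set \<Rightarrow> 'a set"

record ('i, 'n, 'a, 'y) game = "('i, 'n, 'a) game_form" +
  outcome :: "'i \<Rightarrow> ('i, 'n, 'a) hist \<Rightarrow> 'y"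
  payoff  :: "'i \<Rightarrow> ('i, 'n, 'a) hist \<Rightarrow> real"

definition stage :: "('i, 'n, 'a) hist \<Rightarrow> nat" where
  "stage x = length (snd x) + 1"

definition decision_hists :: "('i, 'n, 'a, 'z) game_form_scheme \<Rightarrow> ('i, 'n, 'a) hist set" where
  "decision_hists G = {x \<in> hists G. length (snd x) < horizon G}"

definition hist_prec :: "('i, 'n, 'a) hist \<Rightarrow> ('i, 'n, 'a) hist \<Rightarrow> bool" where
  "hist_prec x y \<longleftrightarrow> fst x = fst y \<and> strict_prefix (snd x) (snd y)"

text \<open>The relation \<open>h \<prec> z\<close> between an information set and a single history is
  \<open>info_prec h {z}\<close>.\<close>

definition info_prec :: "('i, 'n, 'a) hist set \<Rightarrow> ('i, 'n, 'a) hist set \<Rightarrow> bool" where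
  "info_prec h h' \<longleftrightarrow> (\<exists>x\<in>h. \<exists>y\<in>h'. hist_prec x y)"

definition info_of ::
  "('i, 'n, 'a, 'z) game_form_scheme \<Rightarrow> 'i \<Rightarrow> ('i, 'n, 'a) hist \<Rightarrow> ('i, 'n, 'a) hist set" where
  "info_of G i x = (THE h. h \<in> info G i \<and> x \<in> h)"

text \<open>The sequence of information sets of \<open>i\<close> passed strictly before \<open>x\<close>, each with the
  action that \<open>i\<close> took there.\<close>

definition own_record :: "('i, 'n, 'a, 'z) game_form_scheme \<Rightarrow> 'i \<Rightarrow> ('i, 'n, 'a) hist
    \<Rightarrow> (('i, 'n, 'a) hist set \<times> 'a) list" where
  "own_record G i x =
     map (\<lambda>k. (info_of G i (fst x, take k (snd x)), (snd x ! k) i)) [0..<length (snd x)]"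

definition perfect_recall :: "('i, 'n, 'a, 'z) game_form_scheme \<Rightarrow> bool" where
  "perfect_recall G \<longleftrightarrow>
     (\<forall>i. \<forall>h\<in>info G i. \<forall>x\<in>h. \<forall>y\<in>h. own_record G i x = own_record G i y)"

definition multistage_form :: "('i::finite, 'n, 'a, 'z) game_form_scheme \<Rightarrow> bool" where
  "multistage_form G \<longleftrightarrow>
     finite (nature G) \<and> nature G \<noteq> {} \<and> horizon G \<ge> 1 \<and>
     (\<forall>\<theta>. (\<theta>, []) \<in> hists G \<longleftrightarrow> \<theta> \<in> nature G) \<and>
     (\<forall>\<theta> as p. (\<theta>, as @ [p]) \<in> hists G \<longleftrightarrow>
        (\<theta>, as) \<in> decision_hists G \<and> (\<forall>i. p i \<in> avail G i (info_of G i (\<theta>, as)))) \<and>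
     (\<forall>i. partition_on (decision_hists G) (info G i)) \<and>
     (\<forall>i. \<forall>h\<in>info G i. \<forall>x\<in>h. \<forall>y\<in>h. stage x = stage y) \<and>
     (\<forall>i. \<forall>h\<in>info G i. finite (avail G i h) \<and> avail G i h \<noteq> {}) \<and>
     perfect_recall G"

definition active_infos ::
  "('i, 'n, 'a, 'z) game_form_scheme \<Rightarrow> 'i \<Rightarrow> ('i, 'n, 'a) hist set set" where
  "active_infos G i = {h \<in> info G i. card (avail G i h) > 1}"


section \<open>Strategies\<close>

text \<open>A reduced strategy is a partial map on information sets whose domain consists exactly of
  those information sets that the map itself does not rule out.\<close>

type_synonym ('i, 'n, 'a) strat = "('i, 'n, 'a) hist set \<rightharpoonup> 'a"

definition allowed :: "('i, 'n, 'a, 'z) game_form_scheme \<Rightarrow> 'i \<Rightarrow> ('i, 'n, 'a) strat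
    \<Rightarrow> ('i, 'n, 'a) hist set set" where
  "allowed G i s = {h \<in> info G i. \<exists>x\<in>h. \<forall>(h', a) \<in> set (own_record G i x). s h' = Some a}"

definition strategies ::
  "('i, 'n, 'a, 'z) game_form_scheme \<Rightarrow> 'i \<Rightarrow> ('i, 'n, 'a) strat set" where
  "strategies G i = {s. dom s = allowed G i s \<and> (\<forall>h a. s h = Some a \<longrightarrow> a \<in> avail G i h)}"

text \<open>A strategy of the opponents includes the move of nature.\<close>

type_synonym ('i, 'n, 'a) opp = "'n \<times> ('i \<Rightarrow> ('i, 'n, 'a) strat)"

definition opponents ::
  "('i, 'n, 'a, 'z) game_form_scheme \<Rightarrow> 'i \<Rightarrow> ('i, 'n, 'a) opp set" where
  "opponents G i = nature G \<times> (\<Pi>\<^sub>E j\<in>UNIV - {i}. strategies G j)"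

primrec play :: "('i, 'n, 'a, 'z) game_form_scheme \<Rightarrow> ('i \<Rightarrow> ('i, 'n, 'a) strat) \<Rightarrow> 'n
    \<Rightarrow> nat \<Rightarrow> ('i, 'n, 'a) hist" where
  "play G \<sigma> \<theta> 0 = (\<theta>, [])"
| "play G \<sigma> \<theta> (Suc k) =
     (\<theta>, snd (play G \<sigma> \<theta> k) @ [\<lambda>j. the (\<sigma> j (info_of G j (play G \<sigma> \<theta> k)))])"

definition zeta :: "('i, 'n, 'a, 'z) game_form_scheme \<Rightarrow> 'i \<Rightarrow> ('i, 'n, 'a) strat
    \<Rightarrow> ('i, 'n, 'a) opp \<Rightarrow> ('i, 'n, 'a) hist" where
  "zeta G i s t = play G ((snd t)(i := s)) (fst t) (horizon G)"

definition strats_at :: "('i, 'n, 'a, 'z) game_form_scheme \<Rightarrow> 'i \<Rightarrow> ('i, 'n, 'a) hist set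
    \<Rightarrow> ('i, 'n, 'a) strat set" where
  "strats_at G i h =
     {s \<in> strategies G i. \<exists>t\<in>opponents G i. info_prec h {zeta G i s t}}"

definition opps_at :: "('i, 'n, 'a, 'z) game_form_scheme \<Rightarrow> 'i \<Rightarrow> ('i, 'n, 'a) hist set
    \<Rightarrow> ('i, 'n, 'a) opp set" where
  "opps_at G i h =
     {t \<in> opponents G i. \<exists>s\<in>strategies G i. info_prec h {zeta G i s t}}"

definition strats_choosing :: "('i, 'n, 'a, 'z) game_form_scheme \<Rightarrow> 'i
    \<Rightarrow> ('i, 'n, 'a) hist set \<Rightarrow> 'a \<Rightarrow> ('i, 'n, 'a) strat set" where
  "strats_choosing G i h a = {s \<in> strats_at G i h. s h = Some a}"

definition terminals_after :: "('i, 'n, 'a, 'z) game_form_scheme \<Rightarrow> 'i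
    \<Rightarrow> ('i, 'n, 'a) hist set \<Rightarrow> 'a \<Rightarrow> ('i, 'n, 'a) opp \<Rightarrow> ('i, 'n, 'a) hist set" where
  "terminals_after G i h a t = (\<lambda>s. zeta G i s t) ` strats_choosing G i h a"

definition active_infos_under :: "('i, 'n, 'a, 'z) game_form_scheme \<Rightarrow> 'i
    \<Rightarrow> ('i, 'n, 'a) strat \<Rightarrow> ('i, 'n, 'a) hist set set" where
  "active_infos_under G i s = {h \<in> active_infos G i. s \<in> strats_at G i h}"


section \<open>Local dominance\<close>

definition ending_opps :: "('i, 'n, 'a, 'z) game_form_scheme \<Rightarrow> 'i
    \<Rightarrow> ('i, 'n, 'a) hist set \<Rightarrow> 'a \<Rightarrow> ('i, 'n, 'a) opp set" where
  "ending_opps G i h a =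
     {t \<in> opps_at G i h. \<forall>z\<in>terminals_after G i h a t.
        \<not> (\<exists>h'\<in>active_infos G i. info_prec h h' \<and> info_prec h' {z})}"

definition both_end :: "('i, 'n, 'a, 'z) game_form_scheme \<Rightarrow> 'i \<Rightarrow> ('i, 'n, 'a) hist set
    \<Rightarrow> 'a \<Rightarrow> 'a \<Rightarrow> ('i, 'n, 'a) opp set" where
  "both_end G i h a b = ending_opps G i h a \<inter> ending_opps G i h b"

definition only_first_ends :: "('i, 'n, 'a, 'z) game_form_scheme \<Rightarrow> 'i
    \<Rightarrow> ('i, 'n, 'a) hist set \<Rightarrow> 'a \<Rightarrow> 'a \<Rightarrow> ('i, 'n, 'a) opp set" where
  "only_first_ends G i h a b = ending_opps G i h a - ending_opps G i h b"

definition none_ends :: "('i, 'n, 'a, 'z) game_form_scheme \<Rightarrow> 'i \<Rightarrow> ('i, 'n, 'a) hist set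
    \<Rightarrow> 'a \<Rightarrow> 'a \<Rightarrow> ('i, 'n, 'a) opp set" where
  "none_ends G i h a b = opps_at G i h - (ending_opps G i h a \<union> ending_opps G i h b)"

definition local_partition :: "('i, 'n, 'a, 'z) game_form_scheme \<Rightarrow> 'i
    \<Rightarrow> ('i, 'n, 'a) hist set \<Rightarrow> 'a \<Rightarrow> 'a \<Rightarrow> ('i, 'n, 'a) opp set set" where
  "local_partition G i h a' a =
     {both_end G i h a' a, only_first_ends G i h a' a, only_first_ends G i h a a',
      none_ends G i h a' a}"

definition first_active :: "('i, 'n, 'a, 'z) game_form_scheme \<Rightarrow> 'i
    \<Rightarrow> ('i, 'n, 'a) hist set \<Rightarrow> 'a \<Rightarrow> ('i, 'n, 'a) hist set set" where
  "first_active G i h a =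
     {h' \<in> active_infos G i. info_prec h h' \<and>
        (\<exists>s\<in>strats_choosing G i h a. s \<in> strats_at G i h') \<and>
        \<not> (\<exists>h''\<in>active_infos G i. info_prec h h'' \<and> info_prec h'' h')}"

text \<open>All elements of an information set have the same stage, so \<open>\<tau>(h) = \<tau>(h')\<close> says that
  elements of the two sets have equal stages.\<close>

definition mimics :: "('i, 'n, 'a, 'z) game_form_scheme \<Rightarrow> 'i \<Rightarrow> ('i, 'n, 'a) hist set
    \<Rightarrow> ('i, 'n, 'a) opp set \<Rightarrow> ('i, 'n, 'a) strat \<Rightarrow> ('i, 'n, 'a) strat \<Rightarrow> bool" where
  "mimics G i h S s' s \<longleftrightarrow>
     (\<forall>t\<in>S. \<forall>k\<in>first_active G i h (the (s' h)). \<forall>h1\<in>info G i. \<forall>h2\<in>info G i.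
        (k = h1 \<or> info_prec k h1) \<and> info_prec h1 {zeta G i s' t} \<and>
        info_prec h2 {zeta G i s t} \<and> (\<forall>x\<in>h1. \<forall>y\<in>h2. stage x = stage y)
        \<longrightarrow> s' h1 = s h2)"

definition locally_dominates :: "('i, 'n, 'a, 'y, 'z) game_scheme \<Rightarrow> 'i
    \<Rightarrow> ('i, 'n, 'a) hist set \<Rightarrow> 'a \<Rightarrow> 'a \<Rightarrow> bool" where
  "locally_dominates G i h a' a \<longleftrightarrow>
     (\<forall>S\<in>local_partition G i h a' a. S \<noteq> {} \<longrightarrow>
       (\<forall>s\<in>strats_choosing G i h a. \<exists>s'\<in>strats_choosing G i h a'.
          mimics G i h S s' s \<and>
          (S \<in> {both_end G i h a' a, only_first_ends G i h a' a, only_first_ends G i h a a'} \<longrightarrow>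
             Min ((\<lambda>t. payoff G i (zeta G i s' t)) ` S)
               \<ge> Max ((\<lambda>t. payoff G i (zeta G i s t)) ` S)) \<and>
          (S = none_ends G i h a' a \<longrightarrow>
             (\<forall>t\<in>S. outcome G i (zeta G i s' t) = outcome G i (zeta G i s t)))))"

definition locally_dominant :: "('i, 'n, 'a, 'y, 'z) game_scheme \<Rightarrow> 'i
    \<Rightarrow> ('i, 'n, 'a) hist set \<Rightarrow> 'a \<Rightarrow> bool" where
  "locally_dominant G i h a' \<longleftrightarrow>
     a' \<in> avail G i h \<and> (\<forall>a\<in>avail G i h - {a'}. locally_dominates G i h a' a)"

definition locally_dominant_strategy :: "('i, 'n, 'a, 'y, 'z) game_scheme \<Rightarrow> 'i
    \<Rightarrow> ('i, 'n, 'a) strat \<Rightarrow> bool" where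
  "locally_dominant_strategy G i s \<longleftrightarrow>
     s \<in> strategies G i \<and>
     (\<forall>h\<in>active_infos_under G i s. locally_dominant G i h (the (s h)))"

definition locally_strategy_proof :: "('i, 'n, 'a, 'y, 'z) game_scheme \<Rightarrow> bool" where
  "locally_strategy_proof G \<longleftrightarrow> (\<forall>i. \<exists>s. locally_dominant_strategy G i s)"


section \<open>Object allocation mechanisms\<close>

text \<open>In a ranking \<open>r\<close>, \<open>(x, y) \<in> r\<close> means that \<open>x\<close> is strictly preferred to \<open>y\<close>.\<close>

definition rankings :: "'o rel set" where
  "rankings = {r. strict_linear_order r}"

definition profiles :: "('i \<Rightarrow> 'o rel) set" where
  "profiles = {\<theta>. \<forall>i. \<theta> i \<in> rankings}"

definition represents :: "('o \<Rightarrow> real) \<Rightarrow> 'o rel \<Rightarrow> bool" where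
  "represents v r \<longleftrightarrow> (\<forall>x y. (x, y) \<in> r \<longleftrightarrow> v x > v y)"

text \<open>The rules of a mechanism speak about sequences of action profiles only, so they cannot
  depend on preferences: \<open>seqs\<close> are the feasible sequences of all lengths up to \<open>rounds\<close>,
  \<open>cells\<close> is what a player may learn about past play, and \<open>menu\<close> gives the available
  actions.\<close>

record ('i, 'a, 'o) mechanism =
  rounds :: nat
  seqs   :: "('i \<Rightarrow> 'a) list set"
  cells  :: "'i \<Rightarrow> ('i \<Rightarrow> 'a) list set set"
  menu   :: "'i \<Rightarrow> ('i \<Rightarrow> 'a) list set \<Rightarrow> 'a set"
  alloc  :: "('i \<Rightarrow> 'a) list \<Rightarrow> 'i \<Rightarrow> 'o"

text \<open>An information set pairs a ranking with a cell, and \<open>snd ` h\<close> recovers the cell.\<close>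

definition mech_form ::
  "('i, 'a, 'o) mechanism \<Rightarrow> ('i, 'i \<Rightarrow> 'o rel, 'a) game_form" where
  "mech_form M =
     \<lparr> nature = profiles,
       horizon = rounds M,
       hists = profiles \<times> seqs M,
       info = (\<lambda>i. {{\<theta> \<in> profiles. \<theta> i = r} \<times> c | r c. r \<in> rankings \<and> c \<in> cells M i}),
       avail = (\<lambda>i h. menu M i (snd ` h)) \<rparr>"

definition is_mechanism :: "('i::finite, 'a, 'o) mechanism \<Rightarrow> bool" where
  "is_mechanism M \<longleftrightarrow>
     multistage_form (mech_form M) \<and>
     (\<forall>as\<in>seqs M. length as = rounds M \<longrightarrow> bij (alloc M as))"

definition induced_game :: "('i, 'a, 'o) mechanism \<Rightarrow> ('i \<Rightarrow> 'o rel \<Rightarrow> 'o \<Rightarrow> real)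
    \<Rightarrow> ('i, 'i \<Rightarrow> 'o rel, 'a, 'o) game" where
  "induced_game M v =
     \<lparr> nature = nature (mech_form M), horizon = horizon (mech_form M),
       hists = hists (mech_form M), info = info (mech_form M), avail = avail (mech_form M),
       outcome = (\<lambda>i z. alloc M (snd z) i),
       payoff = (\<lambda>i z. v i (fst z i) (alloc M (snd z) i)) \<rparr>"


section \<open>The top trading cycles rule\<close>

text \<open>\<open>endow i\<close> is the object initially owned by \<open>i\<close>; \<open>R\<close> is the set of unassigned
  agents, so the available objects are \<open>endow ` R\<close>.\<close>

definition points_to :: "('i \<Rightarrow> 'o) \<Rightarrow> ('i \<Rightarrow> 'o rel) \<Rightarrow> 'i set \<Rightarrow> 'i \<Rightarrow> 'i" where
  "points_to endow \<theta> R i =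
     (THE j. j \<in> R \<and> (\<forall>k\<in>R - {j}. (endow j, endow k) \<in> \<theta> i))"

definition in_cycle :: "('i \<Rightarrow> 'o) \<Rightarrow> ('i \<Rightarrow> 'o rel) \<Rightarrow> 'i set \<Rightarrow> 'i set" where
  "in_cycle endow \<theta> R = {i \<in> R. \<exists>n>0. (points_to endow \<theta> R ^^ n) i = i}"

primrec unassigned :: "('i \<Rightarrow> 'o) \<Rightarrow> ('i \<Rightarrow> 'o rel) \<Rightarrow> nat \<Rightarrow> 'i set" where
  "unassigned endow \<theta> 0 = UNIV"
| "unassigned endow \<theta> (Suc k) =
     unassigned endow \<theta> k - in_cycle endow \<theta> (unassigned endow \<theta> k)"

text \<open>Agent \<open>i\<close> is assigned in the unique round in which she lies on a cycle.\<close>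

definition ttc :: "('i \<Rightarrow> 'o) \<Rightarrow> ('i \<Rightarrow> 'o rel) \<Rightarrow> 'i \<Rightarrow> 'o" where
  "ttc endow \<theta> i =
     (let k = (LEAST k. i \<in> in_cycle endow \<theta> (unassigned endow \<theta> k))
      in endow (points_to endow \<theta> (unassigned endow \<theta> k) i))"

end

(* In the mechanism agents point at agents.  A pointer is fixed while its target is unassigned;
   when the target leaves, the agent points again at any remaining agent.  An agent remembers her
   own actions and sees who remains, but nobody sees the pointers of others.  Sincere pointing runs
   TTC.  For local dominance of the top choice a' over a, an imagined run after a is copied: from
   the first time the agent points again after a', she points wherever the given strategy would
   point by then in the run after a.  The two runs agree until she leaves in one of them, and if she
   leaves in the run after a first, the pointers leading from her object back to her stay frozen in
   the other run until she closes the same cycle there. *)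

theory Submission
  imports Defs
begin

section \<open>Cycles of a self-map\<close>

text \<open>The copy must be fixed before the opponents are known, and after \<open>a'\<close> the
  agent cannot see how the run after \<open>a\<close> would have gone. Privacy of the pointers
  removes this obstacle: while the same agents have left in both runs, the others observe the same
  and act alike, so the removals seen after \<open>a'\<close> and her own imagined actions together
  determine the information set that \<open>s\<close> would face. Once she has left in the imagined
  run, only a repeated action is left to copy. The comparison of worst with best payoffs is then
  easy. If \<open>a'\<close> ends her activity, she gets her favourite among the remaining objects,
  and nothing better can be had from there. If only \<open>a\<close> ends it, \<open>s\<close>
  yields the target of \<open>a\<close> against every opponent in the cell, and the copy gets the
  same object. If neither does, copy and \<open>s\<close> get equal objects. Keeping a pointer does
  not distort TTC, because a favourite that is still present stays the favourite among fewer
  objects.\<close>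

definition cyc :: "('i \<Rightarrow> 'i) \<Rightarrow> 'i set \<Rightarrow> 'i set" where
  "cyc f R = {i \<in> R. \<exists>n>0. (f ^^ n) i = i}"

lemma in_cycle_eq_cyc: "in_cycle endow \<theta> R = cyc (points_to endow \<theta> R) R"
  by (simp add: in_cycle_def cyc_def)

lemma cyc_subset: "cyc f R \<subseteq> R"
  by (auto simp: cyc_def)

lemma funpow_mem:
  assumes "f ` R \<subseteq> R" "x \<in> R"
  shows "(f ^^ n) x \<in> R"
  using assms by (induction n) auto

lemma cyc_step:
  assumes "f ` R \<subseteq> R" "x \<in> cyc f R"
  shows "f x \<in> cyc f R"
proof -
  obtain n where n: "n > 0" "(f ^^ n) x = x" and x: "x \<in> R"
    using assms(2) by (auto simp: cyc_def)
  have "(f ^^ n) (f x) = f x"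
    using n(2) by (metis funpow_swap1)
  then show ?thesis
    using n(1) x assms(1) by (auto simp: cyc_def)
qed

lemma funpow_mult_fixed:
  assumes "(f ^^ n) x = x"
  shows "(f ^^ (n * m)) x = x"
  using assms by (induction m) (auto simp: funpow_add)

lemma bij_betw_cyc:
  assumes "finite R" "f ` R \<subseteq> R"
  shows "bij_betw f (cyc f R) (cyc f R)"
proof -
  have inj: "inj_on f (cyc f R)"
  proof
    fix x y assume x: "x \<in> cyc f R" and y: "y \<in> cyc f R" and eq: "f x = f y"
    obtain n where n: "n > 0" "(f ^^ n) x = x" using x by (auto simp: cyc_def)
    obtain m where m: "m > 0" "(f ^^ m) y = y" using y by (auto simp: cyc_def)
    \<comment> \<open>\<open>n * m\<close> is a common period of \<open>x\<close> and
      \<open>y\<close>. All but the first of its steps lead from the common image back to both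
      points.\<close>
    obtain k where k: "n * m = Suc k" using n(1) m(1) by (metis mult_pos_pos gr0_conv_Suc)
    have "x = (f ^^ Suc k) x" using funpow_mult_fixed[OF n(2), of m] k by simp
    also have "\<dots> = (f ^^ Suc k) y" using eq by (simp add: funpow_swap1)
    also have "\<dots> = y" using funpow_mult_fixed[OF m(2), of n] k by (simp add: mult.commute)
    finally show "x = y" .
  qed
  moreover have "f ` cyc f R \<subseteq> cyc f R" using cyc_step[OF assms(2)] by auto
  moreover have "finite (cyc f R)" using assms(1) cyc_subset finite_subset by metis
  ultimately show ?thesis by (simp add: bij_betw_def endo_inj_surj)
qed

lemma cyc_nonempty:
  assumes "finite R" "R \<noteq> {}" "f ` R \<subseteq> R"
  shows "cyc f R \<noteq> {}"
proof -
  obtain x where x: "x \<in> R" using assms(2) by auto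
  have "\<not> inj_on (\<lambda>n. (f ^^ n) x) (UNIV :: nat set)"
  proof
    assume "inj_on (\<lambda>n. (f ^^ n) x) (UNIV :: nat set)"
    moreover have "finite ((\<lambda>n. (f ^^ n) x) ` (UNIV :: nat set))"
      using funpow_mem[OF assms(3) x] finite_subset[OF _ assms(1)] by (metis image_subsetI)
    ultimately show False using finite_imageD by blast
  qed
  then obtain m n where "m < n" "(f ^^ m) x = (f ^^ n) x"
    by (metis (mono_tags, lifting) injI linorder_neqE_nat)
  then have "(f ^^ (n - m)) ((f ^^ m) x) = (f ^^ m) x"
    by (metis add.commute comp_apply funpow_add le_add_diff_inverse less_imp_le)
  moreover have "n - m > 0" using \<open>m < n\<close> by simp
  ultimately have "(f ^^ m) x \<in> cyc f R"
    using funpow_mem[OF assms(3) x, of m] unfolding cyc_def by blast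
  then show ?thesis by blast
qed

text \<open>A cycle that misses \<open>i\<close> never uses the pointer of \<open>i\<close>, the
  only place where the two maps may differ.\<close>

lemma cyc_subset_off:
  assumes "f ` R \<subseteq> R" "\<forall>x\<in>R - {i}. f x = g x" "i \<notin> cyc f R"
  shows "cyc f R \<subseteq> cyc g R"
proof
  fix x assume x: "x \<in> cyc f R"
  have orbit: "(f ^^ n) x \<in> cyc f R" for n
    using x cyc_step[OF assms(1)] by (induction n) auto
  have "(g ^^ n) x = (f ^^ n) x" for n
  proof (induction n)
    case (Suc n)
    have "(f ^^ n) x \<in> R - {i}" using orbit[of n] assms(3) cyc_subset[of f R] by auto
    then show ?case using Suc assms(2) by simp
  qed simp
  then show "x \<in> cyc g R" using x by (simp add: cyc_def)
qed

lemma cyc_cong_off: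
  assumes "f ` R \<subseteq> R" "g ` R \<subseteq> R" "\<forall>x\<in>R - {i}. f x = g x" "i \<notin> cyc f R" "i \<notin> cyc g R"
  shows "cyc f R = cyc g R"
proof
  show "cyc f R \<subseteq> cyc g R" using cyc_subset_off[of f R i g] assms by auto
  show "cyc g R \<subseteq> cyc f R" using cyc_subset_off[of g R i f] assms by auto
qed

lemma cyc_cong:
  assumes "f ` R \<subseteq> R" "\<forall>x\<in>R. f x = g x"
  shows "cyc f R = cyc g R"
proof -
  have "(g ^^ n) x = (f ^^ n) x" if "x \<in> R" for x n
    using that funpow_mem[OF assms(1) that] assms(2) by (induction n) auto
  then show ?thesis by (auto simp: cyc_def)
qed

text \<open>The pointer of \<open>i\<close> is never followed, so whether a path back to
  \<open>i\<close> exists does not depend on what \<open>i\<close> does. This carries paths over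
  between runs in which only \<open>i\<close> acts differently.\<close>

inductive leads_to :: "('i \<Rightarrow> 'i) \<Rightarrow> 'i set \<Rightarrow> 'i \<Rightarrow> 'i \<Rightarrow> bool" for f R i where
  refl: "leads_to f R i i"
| step: "x \<in> R \<Longrightarrow> x \<noteq> i \<Longrightarrow> leads_to f R i (f x) \<Longrightarrow> leads_to f R i x"

lemma leads_to_mem: "leads_to f R i x \<Longrightarrow> i \<in> R \<Longrightarrow> x \<in> R"
  by (auto elim: leads_to.cases)

text \<open>Agreement is asked only where the old pointer leads on to \<open>i\<close>. When
  pointers are frozen, these are the agents whose targets are known to remain.\<close>

lemma leads_to_cong:
  assumes "leads_to f R i x" "\<And>x. x \<in> R \<Longrightarrow> x \<noteq> i \<Longrightarrow> leads_to f R i (f x) \<Longrightarrow> g x = f x"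
  shows "leads_to g R i x"
  using assms(1)
proof induction
  case refl
  show ?case by (rule leads_to.refl)
next
  case (step x)
  then show ?case using assms(2) by (metis leads_to.step)
qed

text \<open>Cycles are closed under \<open>f\<close>, so from a cycle one never reaches an
  \<open>i\<close> off all cycles. Removing the cycles therefore leaves every path to
  \<open>i\<close> intact.\<close>

lemma leads_to_diff_cyc:
  assumes "leads_to f R i x" "f ` R \<subseteq> R" "i \<notin> cyc f R"
  shows "x \<notin> cyc f R \<and> leads_to f (R - cyc f R) i x"
  using assms(1)
proof induction
  case refl
  then show ?case using assms(3) leads_to.refl by metis
next
  case (step x)
  then show ?case using cyc_step[OF assms(2), of x] by (auto intro: leads_to.step)
qed

lemma cyc_iff_leads_to:
  assumes "f ` R \<subseteq> R" "i \<in> R"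
  shows "i \<in> cyc f R \<longleftrightarrow> leads_to f R i (f i)"
proof
  have "leads_to f R i x" if "x \<in> R" "(f ^^ e) x = i" for x e
    using that
  proof (induction e arbitrary: x)
    case 0
    then show ?case by (simp add: leads_to.refl)
  next
    case (Suc e)
    then have "leads_to f R i (f x)" using assms(1) by (auto simp: funpow_swap1)
    then show ?case using Suc(2) leads_to.step leads_to.refl by metis
  qed
  moreover assume "i \<in> cyc f R"
  then obtain n where "(f ^^ Suc n) i = i" by (auto simp: cyc_def gr0_conv_Suc)
  then have "(f ^^ n) (f i) = i" by (simp add: funpow_swap1)
  ultimately show "leads_to f R i (f i)" using assms by blast
next
  have "\<exists>e. (f ^^ e) x = i" if "leads_to f R i x" for x
    using that
  proof induction
    case refl
    show ?case by (metis funpow_0)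
  next
    case (step x)
    then obtain e where "(f ^^ e) (f x) = i" by auto
    then have "(f ^^ Suc e) x = i" by (simp add: funpow_swap1)
    then show ?case by blast
  qed
  moreover assume "leads_to f R i (f i)"
  ultimately obtain e where "(f ^^ e) (f i) = i" by auto
  then have "(f ^^ Suc e) i = i" by (simp add: funpow_swap1)
  then show "i \<in> cyc f R" using assms(2) unfolding cyc_def by blast
qed

section \<open>The pointing protocol\<close>

text \<open>Without a second code, the last remaining agent would receive her own object without being
  active, so that never being active again would not mean receiving the target of one's action.\<close>

locale pointing =
  fixes target :: "'a \<Rightarrow> 'i::finite" and Acts :: "'a set"
  assumes finite_Acts: "finite Acts"
    and two_codes: "\<And>j. \<exists>a\<in>Acts. \<exists>b\<in>Acts. a \<noteq> b \<and> target a = j \<and> target b = j"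
begin

definition remaining :: "('i \<Rightarrow> 'a) list \<Rightarrow> 'i set" where
  "remaining = foldl (\<lambda>R p. R - cyc (target \<circ> p) R) UNIV"

definition free :: "'i \<Rightarrow> ('i \<Rightarrow> 'a) list \<Rightarrow> bool" where
  "free i as \<longleftrightarrow> i \<in> remaining as \<and> (as = [] \<or> target (last as i) \<notin> remaining as)"

text \<open>The dummy action is a repetition rather than a blank, so the last profile always shows
  every current pointer and, in the end, the whole assignment.\<close>

definition options :: "'i \<Rightarrow> ('i \<Rightarrow> 'a) list \<Rightarrow> 'a set" where
  "options i as = (if free i as then {a \<in> Acts. target a \<in> remaining as} else {last as i})"

definition feasible :: "('i \<Rightarrow> 'a) list \<Rightarrow> bool" where
  "feasible as \<longleftrightarrow> (\<forall>k<length as. \<forall>i. (as ! k) i \<in> options i (take k as))"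

text \<open>The range includes \<open>length as\<close> itself, so that the result of the latest
  round is seen before the next action.\<close>

definition obs :: "'i \<Rightarrow> ('i \<Rightarrow> 'a) list \<Rightarrow> 'a list \<times> 'i set list" where
  "obs i as = (map (\<lambda>p. p i) as, map (\<lambda>k. remaining (take k as)) [0..<Suc (length as)])"

lemma remaining_Nil [simp]: "remaining [] = UNIV"
  by (simp add: remaining_def)

lemma remaining_snoc: "remaining (as @ [p]) = remaining as - cyc (target \<circ> p) (remaining as)"
  by (simp add: remaining_def)

lemma remaining_append_subset: "remaining (as @ bs) \<subseteq> remaining as"
proof (induction bs rule: rev_induct)
  case (snoc p bs)
  then show ?case using remaining_snoc[of "as @ bs" p] by auto
qed simp

lemma remaining_take_mono: "k \<le> m \<Longrightarrow> remaining (take m as) \<subseteq> remaining (take k as)"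
  using remaining_append_subset[of "take k (take m as)" "drop k (take m as)"]
  by (metis append_take_drop_id min.absorb1 take_take)

lemma feasible_Nil [simp]: "feasible []"
  by (simp add: feasible_def)

lemma feasible_snoc: "feasible (as @ [p]) \<longleftrightarrow> feasible as \<and> (\<forall>i. p i \<in> options i as)"
  by (auto simp: feasible_def nth_append less_Suc_eq)

lemma feasible_take: "feasible as \<Longrightarrow> feasible (take k as)"
  by (auto simp: feasible_def min_def)

lemma options_finite: "finite (options i as)"
  using finite_Acts by (auto simp: options_def)

lemma options_card: "card (options i as) > 1 \<longleftrightarrow> free i as"
proof
  assume free: "free i as"
  obtain a b where "a \<in> Acts" "b \<in> Acts" "a \<noteq> b" "target a = i" "target b = i"
    using two_codes by blast
  then have "{a, b} \<subseteq> options i as" "card {a, b} = 2"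
    using free by (auto simp: options_def free_def)
  then show "card (options i as) > 1" using card_mono[OF options_finite] by (metis Suc_1 Suc_le_eq)
qed (auto simp: options_def split: if_splits)

lemma options_nonempty: "options i as \<noteq> {}"
  using options_card[of i as] card.empty by (cases "free i as") (force, simp add: options_def)

lemma target_option:
  assumes "i \<in> remaining as" "a \<in> options i as"
  shows "target a \<in> remaining as"
  using assms by (auto simp: options_def free_def split: if_splits)

lemma option_unfree: "\<not> free i as \<Longrightarrow> a \<in> options i as \<longleftrightarrow> a = last as i"
  by (simp add: options_def)

lemma unfree_assigned: "i \<notin> remaining as \<Longrightarrow> \<not> free i as"
  by (simp add: free_def)

lemma pointers_closed:
  assumes "\<forall>i. p i \<in> options i as"
  shows "(target \<circ> p) ` remaining as \<subseteq> remaining as"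
  using assms target_option by auto

text \<open>Assigned agents can only repeat their actions, so the permutation built so far persists
  and each round adds a set of cycles to it.\<close>

lemma assigned_bij:
  assumes "feasible as" "as \<noteq> []"
  shows "bij_betw (target \<circ> last as) (- remaining as) (- remaining as)"
  using assms
proof (induction as rule: rev_induct)
  case (snoc p as)
  let ?R = "remaining as" and ?C = "cyc (target \<circ> p) (remaining as)"
  have p: "\<forall>i. p i \<in> options i as" and fe: "feasible as" using snoc(2) by (auto simp: feasible_snoc)
  have closed: "(target \<circ> p) ` ?R \<subseteq> ?R" using pointers_closed[OF p] .
  have "bij_betw (target \<circ> p) (- ?R) (- ?R)"
  proof (cases "as = []")
    case False
    have "p i = last as i" if "i \<in> - ?R" for i
      using that p unfree_assigned option_unfree by (metis ComplD)
    then have "bij_betw (target \<circ> p) (- ?R) (- ?R) \<longleftrightarrow> bij_betw (target \<circ> last as) (- ?R) (- ?R)"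
      by (intro bij_betw_cong) simp
    then show ?thesis using snoc(1)[OF fe False] by simp
  qed (simp add: bij_betw_def)
  moreover have "bij_betw (target \<circ> p) ?C ?C" using bij_betw_cyc[OF _ closed] by simp
  moreover have "- ?R \<inter> ?C = {}" using cyc_subset[of "target \<circ> p" ?R] by auto
  ultimately have "bij_betw (target \<circ> p) (- ?R \<union> ?C) (- ?R \<union> ?C)"
    by (intro bij_betw_combine) auto
  moreover have "- remaining (as @ [p]) = - ?R \<union> ?C" by (auto simp: remaining_snoc)
  ultimately show ?case by (simp only: last_snoc)
qed simp

text \<open>While somebody remains, each round closes at least one cycle. This is why the number of
  agents serves as the horizon.\<close>

lemma card_remaining:
  assumes "feasible as"
  shows "card (remaining as) \<le> card (UNIV :: 'i set) - length as"
  using assms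
proof (induction as rule: rev_induct)
  case (snoc p as)
  let ?R = "remaining as" and ?C = "cyc (target \<circ> p) (remaining as)"
  have p: "\<forall>i. p i \<in> options i as" and fe: "feasible as" using snoc(2) by (auto simp: feasible_snoc)
  show ?case
  proof (cases "?R = {}")
    case False
    then have "?C \<noteq> {}" using cyc_nonempty[OF _ _ pointers_closed[OF p]] by simp
    then have "card (?R - ?C) < card ?R"
      using cyc_subset[of "target \<circ> p" ?R] by (intro psubset_card_mono) auto
    then show ?thesis using snoc(1)[OF fe] by (simp add: remaining_snoc)
  qed (simp add: remaining_snoc)
qed simp

lemma remaining_empty:
  assumes "feasible as" "length as = card (UNIV :: 'i set)"
  shows "remaining as = {}"
  using card_remaining[OF assms(1)] assms(2) by simp

section \<open>What an agent observes, and what it determines\<close>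

lemma obs_length: "obs i as = obs i bs \<Longrightarrow> length as = length bs"
  unfolding obs_def by (metis length_map prod.inject)

lemma obs_remaining:
  assumes "obs i as = obs i bs" "k \<le> length as"
  shows "remaining (take k as) = remaining (take k bs)"
proof -
  have "map (\<lambda>k. remaining (take k as)) [0..<Suc (length as)] ! k
      = map (\<lambda>k. remaining (take k bs)) [0..<Suc (length bs)] ! k"
    using assms(1) by (simp only: obs_def prod.inject)
  then show ?thesis using assms(2) obs_length[OF assms(1)] by (simp del: upt_Suc)
qed

lemma obs_nth:
  assumes "obs i as = obs i bs" "k < length as"
  shows "(as ! k) i = (bs ! k) i"
proof -
  have "map (\<lambda>p. p i) as ! k = map (\<lambda>p. p i) bs ! k"
    using assms(1) by (simp only: obs_def prod.inject)
  then show ?thesis using assms(2) obs_length[OF assms(1)] by simp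
qed

lemma obs_eqI:
  assumes "length as = length bs"
    and "\<And>k. k < length as \<Longrightarrow> (as ! k) i = (bs ! k) i"
    and "\<And>k. k \<le> length as \<Longrightarrow> remaining (take k as) = remaining (take k bs)"
  shows "obs i as = obs i bs"
  unfolding obs_def prod.inject
proof
  show "map (\<lambda>p. p i) as = map (\<lambda>p. p i) bs"
    using assms by (intro nth_equalityI) auto
  show "map (\<lambda>k. remaining (take k as)) [0..<Suc (length as)]
      = map (\<lambda>k. remaining (take k bs)) [0..<Suc (length bs)]"
    using assms by (intro map_cong) auto
qed

lemma obs_take:
  assumes "obs i as = obs i bs"
  shows "obs i (take k as) = obs i (take k bs)"
proof (rule obs_eqI)
  show l: "length (take k as) = length (take k bs)" using obs_length[OF assms] by simp
  show "(take k as ! j) i = (take k bs ! j) i" if "j < length (take k as)" for j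
    using that obs_nth[OF assms, of j] by simp
  show "remaining (take j (take k as)) = remaining (take j (take k bs))"
    if "j \<le> length (take k as)" for j
    using that obs_remaining[OF assms, of j] by (simp add: min_absorb1)
qed

text \<open>This is what allows the menu and the activity of an agent to be attached to her
  information sets.\<close>

lemma obs_free:
  assumes "obs i as = obs i bs"
  shows "free i as \<longleftrightarrow> free i bs" and "options i as = options i bs"
proof -
  have l: "length as = length bs" using assms by (rule obs_length)
  have R: "remaining as = remaining bs" using obs_remaining[OF assms, of "length as"] l by simp
  have last: "last as i = last bs i" if "as \<noteq> []"
  proof -
    have "bs \<noteq> []" using l that by auto
    then show ?thesis using obs_nth[OF assms, of "length as - 1"] l that by (simp add: last_conv_nth)
  qed
  have e: "as = [] \<longleftrightarrow> bs = []" using l by auto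
  show f: "free i as \<longleftrightarrow> free i bs" unfolding free_def using R last e by metis
  show "options i as = options i bs"
  proof (cases "free i as")
    case False
    then have "as \<noteq> []" by (auto simp: free_def)
    then show ?thesis using False f last by (simp add: options_def)
  qed (use f R in \<open>simp add: options_def\<close>)
qed


lemma options_subset_Acts: "feasible as \<Longrightarrow> options i as \<subseteq> Acts"
proof (induction as rule: rev_induct)
  case (snoc p as)
  then show ?case by (auto simp: feasible_snoc options_def)
qed (auto simp: options_def free_def)

lemma feasible_nth: "feasible as \<Longrightarrow> k < length as \<Longrightarrow> (as ! k) i \<in> options i (take k as)"
  by (simp add: feasible_def)

lemma remaining_take_Suc:
  "k < length as \<Longrightarrow>
   remaining (take (Suc k) as) = remaining (take k as) - cyc (target \<circ> as ! k) (remaining (take k as))"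
  by (simp add: take_Suc_conv_app_nth remaining_snoc)

lemma last_take: "0 < k \<Longrightarrow> k \<le> length as \<Longrightarrow> last (take k as) = as ! (k - 1)"
  by (subst last_conv_nth) (auto simp: min_def)

lemma unfree_nth:
  assumes "feasible as" "0 < k" "k < length as" "\<not> free i (take k as)"
  shows "(as ! k) i = (as ! (k - 1)) i"
  using feasible_nth[OF assms(1,3), of i] option_unfree[OF assms(4)] last_take[of k as] assms by simp

text \<open>\<open>X\<close> and \<open>Y\<close> are two runs that branch when agent \<open>i\<close> acts after \<open>n\<close> rounds; the others
  react to what they observe.  In \<open>Y\<close>, agent \<open>i\<close> tries to follow the virtual actions \<open>V\<close>, which
  agree with her actions in \<open>X\<close> while the removals in both runs agree.  If she leaves earlier in
  \<open>X\<close>, then the path of pointers from the target of \<open>V\<close> back to \<open>i\<close> is frozen in \<open>Y\<close> until she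
  can close the same cycle herself.\<close>

lemma simulation:
  fixes X Y :: "('i \<Rightarrow> 'a) list" and V :: "nat \<Rightarrow> 'a"
  assumes X: "feasible X" "length X = N" and Y: "feasible Y" "length Y = N"
    and n: "take n X = take n Y" "i \<in> remaining (take n X)"
    and opp: "\<And>k l. k < N \<Longrightarrow> l \<noteq> i \<Longrightarrow> obs l (take k X) = obs l (take k Y) \<Longrightarrow> (X ! k) l = (Y ! k) l"
    and V1: "\<And>k. k < N \<Longrightarrow> (\<forall>j\<le>k. remaining (take j X) = remaining (take j Y)) \<Longrightarrow> V k = (X ! k) i"
    and V2: "\<And>k. 0 < k \<Longrightarrow> k < N \<Longrightarrow> target (V (k - 1)) \<in> remaining (take k Y) \<Longrightarrow> V k = V (k - 1)"
    and V3: "\<And>k. n < k \<Longrightarrow> k < N \<Longrightarrow> V k \<in> options i (take k Y) \<Longrightarrow> (Y ! k) i = V k"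
    and k: "n < k0" "k0 \<le> k" "k < N" "free i (take k0 Y)"
  shows "(Y ! k) i = (X ! k) i"
proof -
  \<comment> \<open>\<open>i\<close> has had an occasion to point again in \<open>Y\<close> after
    branching; the conclusion concerns only such rounds. Because of \<open>n < j\<close>,
    \<open>act 0\<close> is false, so \<open>act (k - 1)\<close> is harmless at
    \<open>k = 0\<close>.\<close>
  define act where "act k \<longleftrightarrow> (\<exists>j. n < j \<and> j \<le> k \<and> free i (take j Y))" for k
  define RA where "RA k = remaining (take k X)" for k
  define RB where "RB k = remaining (take k Y)" for k
  \<comment> \<open>The invariant has three phases. In the first, the removals and all actions of
    the others have agreed so far, \<open>i\<close> is unassigned in both runs, and her last actions
    agree if she has pointed again.\<close>
  define sync where "sync k \<longleftrightarrow> (\<forall>j\<le>k. RA j = RB j) \<and> (\<forall>j<k. \<forall>l. l \<noteq> i \<longrightarrow> (X ! j) l = (Y ! j) l)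
    \<and> i \<in> RA k \<and> (act (k - 1) \<longrightarrow> (X ! (k - 1)) i = (Y ! (k - 1)) i)" for k
  \<comment> \<open>In the second phase \<open>i\<close> has left \<open>Y\<close>. If she never
    pointed again, nothing is claimed about \<open>X\<close>: she will not be free in
    \<open>Y\<close> any more, so \<open>act\<close> stays false.\<close>
  define endY where "endY k \<longleftrightarrow> i \<notin> RB k \<and>
    (act (k - 1) \<longrightarrow> i \<notin> RA k \<and> (X ! (k - 1)) i = (Y ! (k - 1)) i)" for k
  \<comment> \<open>In the third phase \<open>i\<close> has left \<open>X\<close> but waits in
    \<open>Y\<close>, with a path back to her from the virtual target.\<close>
  define pend where "pend k \<longleftrightarrow> i \<in> RB k \<and> i \<notin> RA k \<and> 0 < k \<and> V (k - 1) = (X ! (k - 1)) i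
    \<and> leads_to (target \<circ> (Y ! (k - 1))) (RB k) i (target (V (k - 1))) \<and> \<not> act (k - 1)" for k
  define inv where "inv k \<longleftrightarrow> sync k \<or> endY k \<or> pend k" for k

  have act_cases: "act (k - 1) \<or> (n < k \<and> free i (take k Y))" if "act k" for k
  proof -
    obtain j where j: "n < j" "j \<le> k" "free i (take j Y)"
      using \<open>act k\<close> unfolding act_def by blast
    show ?thesis
    proof (cases "j = k")
      case False
      then have "j \<le> k - 1" using j by simp
      then show ?thesis using j act_def by blast
    qed (use j in simp)
  qed
  have act_pos: "0 < k" if "act (k - 1)" for k
    using that by (cases k) (auto simp: act_def)
  have step: "inv (Suc k)" if kN: "k < N" and inv: "inv k" for k
  proof -
    define p where "p = X ! k"
    define q where "q = Y ! k"
    have p: "\<forall>l. p l \<in> options l (take k X)" using feasible_nth[OF X(1)] X(2) kN by (simp add: p_def)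
    have q: "\<forall>l. q l \<in> options l (take k Y)" using feasible_nth[OF Y(1)] Y(2) kN by (simp add: q_def)
    have cp: "(target \<circ> p) ` RA k \<subseteq> RA k" using pointers_closed[OF p] by (simp add: RA_def)
    have cq: "(target \<circ> q) ` RB k \<subseteq> RB k" using pointers_closed[OF q] by (simp add: RB_def)
    have RA: "RA (Suc k) = RA k - cyc (target \<circ> p) (RA k)"
      using remaining_take_Suc[of k X] X(2) kN by (simp add: RA_def p_def)
    have RB: "RB (Suc k) = RB k - cyc (target \<circ> q) (RB k)"
      using remaining_take_Suc[of k Y] Y(2) kN by (simp add: RB_def q_def)
    have pA: "p i \<in> Acts" using p options_subset_Acts[OF feasible_take[OF X(1)]] by blast
    have unX: "p l = (X ! (k - 1)) l" if "\<not> free l (take k X)" "0 < k" for l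
      using unfree_nth[OF X(1) that(2) _ that(1)] X(2) kN by (simp add: p_def)
    have unY: "q l = (Y ! (k - 1)) l" if "\<not> free l (take k Y)" "0 < k" for l
      using unfree_nth[OF Y(1) that(2) _ that(1)] Y(2) kN by (simp add: q_def)
    have lastX: "last (take k X) = X ! (k - 1)" if "0 < k"
      using last_take[OF that, of X] X(2) kN by simp
    have lastY: "last (take k Y) = Y ! (k - 1)" if "0 < k"
      using last_take[OF that, of Y] Y(2) kN by simp
    consider "sync k" | "endY k" | "pend k" using inv by (auto simp: inv_def)
    then show ?thesis
    proof cases
      case 1
      then have eq: "\<forall>j\<le>k. RA j = RB j" and old: "\<forall>j<k. \<forall>l. l \<noteq> i \<longrightarrow> (X ! j) l = (Y ! j) l"
        and iR: "i \<in> RA k" and ac: "act (k - 1) \<Longrightarrow> (X ! (k - 1)) i = (Y ! (k - 1)) i"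
        by (auto simp: sync_def)
      have Vk: "V k = p i" using V1[OF kN] eq by (simp add: RA_def RB_def p_def)
      have others: "p l = q l" if "l \<noteq> i" for l
      proof -
        have "obs l (take k X) = obs l (take k Y)"
          using that eq old kN X(2) Y(2) by (intro obs_eqI) (auto simp: RA_def RB_def min_def)
        then show ?thesis using opp[OF kN that] by (simp add: p_def q_def)
      qed
      \<comment> \<open>If she is free in \<open>Y\<close>, the virtual action is available there
        because its target remains in both runs. If not, equal last actions and equal remaining sets
        force a repetition in \<open>X\<close> too.\<close>
      have same: "q i = p i" if "act k"
      proof (cases "free i (take k Y)")
        case True
        have nk: "n < k" using that by (auto simp: act_def)
        have "target (p i) \<in> RB k" using target_option[of i "take k X" "p i"] p iR eq by (simp add: RA_def RB_def)
        then have "V k \<in> options i (take k Y)" using True Vk pA by (simp add: options_def RB_def)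
        then show ?thesis using V3[OF nk kN] Vk by (simp add: q_def)
      next
        case False
        then have a: "act (k - 1)" using act_cases[OF that] by simp
        have k0: "0 < k" using act_pos[OF a] .
        have qi: "q i = (Y ! (k - 1)) i" using unY[OF False k0] .
        have "target ((Y ! (k - 1)) i) \<in> RB k"
          using False iR eq k0 lastY[OF k0] by (auto simp: free_def RA_def RB_def)
        then have "\<not> free i (take k X)" using ac[OF a] eq lastX[OF k0] k0 X(2) kN
          by (auto simp: free_def RA_def RB_def)
        then show ?thesis using unX[OF _ k0] qi ac[OF a] by simp
      qed
      show ?thesis
      proof (cases "i \<in> cyc (target \<circ> q) (RB k)")
        case True
        have "i \<notin> RA (Suc k)" if "act k"
        proof -
          have "p = q" using same[OF that] others by (metis ext)
          then show ?thesis using True RA eq by simp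
        qed
        then have "endY (Suc k)" using True RB same by (auto simp: endY_def p_def q_def)
        then show ?thesis by (simp add: inv_def)
      next
        case iq: False
        show ?thesis
        proof (cases "i \<in> cyc (target \<circ> p) (RA k)")
          case True
          \<comment> \<open>Had she pointed again, both profiles would coincide and she would leave
            both runs in this round.\<close>
          have na: "\<not> act k"
          proof
            assume "act k"
            then have "p = q" using same others by (metis ext)
            then show False using True iq eq by simp
          qed
          \<comment> \<open>The rest of the cycle in \<open>X\<close> does not use her own pointer,
            so it is also a path in \<open>Y\<close>. It survives the round there because she is on
            no cycle in \<open>Y\<close>.\<close>
          have "leads_to (target \<circ> p) (RA k) i (target (p i))"
            using True cyc_iff_leads_to[OF cp iR] by simp
          then have "leads_to (target \<circ> q) (RB k) i (target (p i))"
            using leads_to_cong[of "target \<circ> p" "RA k" i "target (p i)" "target \<circ> q"] others eq by simp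
          then have "leads_to (target \<circ> q) (RB (Suc k)) i (target (p i))"
            using leads_to_diff_cyc[OF _ cq iq] RB by simp
          then have "pend (Suc k)"
            using na Vk True RA RB iq iR eq by (simp add: pend_def p_def q_def)
          then show ?thesis by (simp add: inv_def)
        next
          case False
          have "cyc (target \<circ> p) (RA k) = cyc (target \<circ> q) (RA k)"
            using cyc_cong_off[of "target \<circ> p" "RA k" "target \<circ> q" i] cp cq others eq iq False by simp
          then have "RA (Suc k) = RB (Suc k)" using RA RB eq by simp
          moreover have "i \<in> RA (Suc k)" using RA iR False by simp
          ultimately have "sync (Suc k)"
            using eq old others same by (auto simp: sync_def p_def q_def le_Suc_eq less_Suc_eq)
          then show ?thesis by (simp add: inv_def)
        qed
      qed
    next
      case 2
      have iB: "i \<notin> RB k" using 2 by (simp add: endY_def)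
      then have nf: "\<not> free i (take k Y)" by (simp add: free_def RB_def)
      have "i \<notin> RA (Suc k) \<and> p i = q i" if "act k"
      proof -
        have a: "act (k - 1)" using act_cases[OF that] nf by simp
        then have iA: "i \<notin> RA k" and e: "(X ! (k - 1)) i = (Y ! (k - 1)) i"
          using 2 by (auto simp: endY_def)
        have "\<not> free i (take k X)" using iA by (simp add: free_def RA_def)
        then show ?thesis using unX unY nf e act_pos[OF a] RA iA by simp
      qed
      then have "endY (Suc k)" using iB RB by (auto simp: endY_def p_def q_def)
      then show ?thesis by (simp add: inv_def)
    next
      case 3
      then have iB: "i \<in> RB k" and iA: "i \<notin> RA k" and k0: "0 < k" and VX: "V (k - 1) = (X ! (k - 1)) i"
        and l: "leads_to (target \<circ> (Y ! (k - 1))) (RB k) i (target (V (k - 1)))" and na: "\<not> act (k - 1)"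
        by (auto simp: pend_def)
      define b where "b = V (k - 1)"
      have bB: "target b \<in> RB k" using leads_to_mem[OF l iB] by (simp add: b_def)
      then have Vk: "V k = b" using V2[OF k0 kN] by (simp add: RB_def b_def)
      have "\<not> free i (take k X)" using iA by (simp add: free_def RA_def)
      then have pi: "p i = b" using unX k0 VX by (simp add: b_def)
      \<comment> \<open>Agents on the path have targets that still remain, so they are not free and
        must repeat their pointers.\<close>
      have l': "leads_to (target \<circ> q) (RB k) i (target b)"
        unfolding b_def
      proof (rule leads_to_cong[OF l])
        fix x assume x: "x \<in> RB k" "x \<noteq> i" "leads_to (target \<circ> (Y ! (k - 1))) (RB k) i ((target \<circ> (Y ! (k - 1))) x)"
        then have "target ((Y ! (k - 1)) x) \<in> RB k" using leads_to_mem[OF _ iB] by fastforce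
        then have "\<not> free x (take k Y)" using lastY[OF k0] k0 Y(2) kN by (auto simp: free_def RB_def)
        then show "(target \<circ> q) x = (target \<circ> (Y ! (k - 1))) x" using unY[OF _ k0] by simp
      qed
      have iA': "i \<notin> RA (Suc k)" using iA RA by simp
      have closes: "q i = b \<and> i \<in> cyc (target \<circ> q) (RB k)" if "act k"
      proof -
        have f: "free i (take k Y)" "n < k" using act_cases[OF that] na by auto
        have "V k \<in> options i (take k Y)" using Vk pi pA bB f by (auto simp: options_def RB_def)
        then have "q i = b" using V3[OF f(2) kN] Vk by (simp add: q_def)
        then show ?thesis using cyc_iff_leads_to[OF cq iB] l' by simp
      qed
      show ?thesis
      proof (cases "i \<in> cyc (target \<circ> q) (RB k)")
        case True
        then have "endY (Suc k)" using RB iA' closes pi by (auto simp: endY_def p_def q_def)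
        then show ?thesis by (simp add: inv_def)
      next
        case False
        then have "\<not> act k" using closes by blast
        moreover have "leads_to (target \<circ> q) (RB (Suc k)) i (target b)"
          using leads_to_diff_cyc[OF l' cq False] RB by simp
        ultimately have "pend (Suc k)" using iB RB False iA' Vk pi by (simp add: pend_def p_def q_def)
        then show ?thesis by (simp add: inv_def)
      qed
    qed
  qed
  have eq0: "take j X = take j Y" if "j \<le> n" for j
    using n(1) that by (metis min.absorb1 take_take)
  have nN: "n < N" using k by simp
  have nth0: "X ! j = Y ! j" if "j < n" for j
    using n(1) that by (metis nth_take)
  have "sync n" using n(2) eq0 nth0 by (auto simp: sync_def RA_def RB_def act_def)
  then have "inv n" by (simp add: inv_def)
  have "inv m" if "n \<le> m" "m \<le> N" for m
    using that
  proof (induction m rule: dec_induct)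
    case base
    show ?case using \<open>inv n\<close> .
  next
    case (step m)
    then show ?case using \<open>\<And>k. k < N \<Longrightarrow> inv k \<Longrightarrow> inv (Suc k)\<close> by simp
  qed
  then have "inv (Suc k)" using k by simp
  moreover have "act k" using k by (auto simp: act_def)
  ultimately show ?thesis by (auto simp: inv_def sync_def endY_def pend_def)
qed

lemma unfree_const:
  assumes "feasible as" "n < length as" "\<And>k. n < k \<Longrightarrow> k < length as \<Longrightarrow> \<not> free i (take k as)"
  shows "last as i = (as ! n) i"
proof -
  have const: "(as ! k) i = (as ! n) i" if "n \<le> k" "k < length as" for k
    using that
  proof (induction k rule: dec_induct)
    case (step m)
    then show ?case using unfree_nth[OF assms(1), of "Suc m" i] assms(3)[of "Suc m"] by simp
  qed simp
  have "(as ! (length as - 1)) i = (as ! n) i" by (rule const) (use assms(2) in auto)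
  then show ?thesis using assms(2) by (subst last_conv_nth) auto
qed

text \<open>A later choice is made from a subset of the agents remaining after \<open>n\<close>
  rounds, and a repetition keeps its target.\<close>

lemma target_last_remaining:
  assumes "feasible as" "n < length as" "i \<in> remaining (take n as)"
  shows "target (last as i) \<in> remaining (take n as)"
proof -
  have "target ((as ! k) i) \<in> remaining (take n as)" if "n \<le> k" "k < length as" for k
    using that
  proof (induction k rule: dec_induct)
    case base
    then show ?case using feasible_nth[OF assms(1,2)] target_option[OF assms(3)] by blast
  next
    case (step m)
    show ?case
    proof (cases "free i (take (Suc m) as)")
      case True
      then have "target ((as ! Suc m) i) \<in> remaining (take (Suc m) as)"
        using feasible_nth[OF assms(1) step(4), of i] target_option[of i "take (Suc m) as"] by (auto simp: free_def)
      then show ?thesis using remaining_take_mono[of n "Suc m" as] step by auto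
    next
      case False
      then show ?thesis using unfree_nth[OF assms(1), of "Suc m" i] step by simp
    qed
  qed
  then have "target ((as ! (length as - 1)) i) \<in> remaining (take n as)" using assms(2) by simp
  then show ?thesis using assms(2) by (subst last_conv_nth) auto
qed

lemma bij_target_last:
  assumes "feasible as" "length as = card (UNIV :: 'i set)"
  shows "bij (target \<circ> last as)"
  using assigned_bij[OF assms(1)] remaining_empty[OF assms] assms(2) by fastforce

end

section \<open>Plays and reduced strategies\<close>

lemma fst_play [simp]: "fst (play G \<sigma> \<theta> k) = \<theta>"
  by (cases k) auto

lemma length_play [simp]: "length (snd (play G \<sigma> \<theta> k)) = k"
  by (induction k) auto

lemma play_eq_pair: "(\<theta>, snd (play G \<sigma> \<theta> k)) = play G \<sigma> \<theta> k"
  by (simp add: prod_eq_iff)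

lemma take_play: "m \<le> k \<Longrightarrow> take m (snd (play G \<sigma> \<theta> k)) = snd (play G \<sigma> \<theta> m)"
  by (induction k) (auto simp: le_Suc_eq)

lemma nth_play:
  assumes "m < k"
  shows "(snd (play G \<sigma> \<theta> k) ! m) j = the (\<sigma> j (info_of G j (play G \<sigma> \<theta> m)))"
proof -
  have "snd (play G \<sigma> \<theta> k) ! m = take (Suc m) (snd (play G \<sigma> \<theta> k)) ! m" by simp
  also have "\<dots> = snd (play G \<sigma> \<theta> (Suc m)) ! m" using assms by (simp only: take_play Suc_leI)
  finally show ?thesis by (simp add: nth_append)
qed

lemma own_record_play:
  "own_record G j (play G \<sigma> \<theta> k)
   = map (\<lambda>m. (info_of G j (play G \<sigma> \<theta> m), the (\<sigma> j (info_of G j (play G \<sigma> \<theta> m))))) [0..<k]"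
  by (auto simp: own_record_def take_play play_eq_pair nth_play)

text \<open>The domain is cut out by the total function \<open>f\<close>, which avoids the
  circularity in the notion of a reduced strategy: there the partial map delimits its own
  domain.\<close>

definition reduced :: "('i, 'n, 'a, 'z) game_form_scheme \<Rightarrow> 'i \<Rightarrow> (('i, 'n, 'a) hist set \<Rightarrow> 'a)
    \<Rightarrow> ('i, 'n, 'a) strat" where
  "reduced G i f = (\<lambda>h. if h \<in> info G i \<and> (\<exists>x\<in>h. \<forall>(h', a) \<in> set (own_record G i x). f h' = a)
     then Some (f h) else None)"

lemma reduced_eq:
  assumes "h \<in> dom (reduced G i f)"
  shows "reduced G i f h = Some (f h)"
proof -
  define P where "P \<longleftrightarrow> h \<in> info G i \<and> (\<exists>x\<in>h. \<forall>(h', a) \<in> set (own_record G i x). f h' = a)"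
  have "reduced G i f h = (if P then Some (f h) else None)" by (simp only: reduced_def P_def)
  then show ?thesis using assms by (simp add: domIff split: if_splits)
qed

locale multistage =
  fixes G :: "('i::finite, 'n, 'a, 'z) game_form_scheme"
  assumes multistage: "multistage_form G"
begin

lemma info_of_eq:
  assumes "h \<in> info G i" "x \<in> h"
  shows "info_of G i x = h"
proof -
  have "disjoint (info G i)"
    using multistage by (auto simp: multistage_form_def partition_on_def)
  then show ?thesis
    unfolding info_of_def using assms by (intro the_equality) (auto dest: disjointD)
qed

lemma info_of_mem:
  assumes "x \<in> decision_hists G"
  shows "info_of G i x \<in> info G i" "x \<in> info_of G i x"
proof -
  have "\<Union> (info G i) = decision_hists G"
    using multistage by (auto simp: multistage_form_def partition_on_def)
  then obtain h where "h \<in> info G i" "x \<in> h" using assms by auto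
  then show "info_of G i x \<in> info G i" "x \<in> info_of G i x" using info_of_eq by auto
qed

lemma info_decision:
  assumes "h \<in> info G i" "x \<in> h"
  shows "x \<in> decision_hists G"
proof -
  have "\<Union> (info G i) = decision_hists G"
    using multistage by (auto simp: multistage_form_def partition_on_def)
  then show ?thesis using assms by auto
qed

lemma hists_snoc:
  "(\<theta>, as @ [p]) \<in> hists G \<longleftrightarrow>
     (\<theta>, as) \<in> decision_hists G \<and> (\<forall>i. p i \<in> avail G i (info_of G i (\<theta>, as)))"
proof -
  have "\<forall>\<theta> as p. (\<theta>, as @ [p]) \<in> hists G \<longleftrightarrow>
      (\<theta>, as) \<in> decision_hists G \<and> (\<forall>i. p i \<in> avail G i (info_of G i (\<theta>, as)))"
    using multistage unfolding multistage_form_def by (elim conjE) assumption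
  then show ?thesis by (elim allE)
qed

lemma hists_take:
  assumes "(\<theta>, as) \<in> hists G" "k < length as"
  shows "(\<theta>, take k as) \<in> decision_hists G"
  using assms
proof (induction as rule: rev_induct)
  case (snoc p as)
  then have d: "(\<theta>, as) \<in> decision_hists G" by (simp add: hists_snoc)
  then show ?case using snoc(1,3) by (cases "k < length as") (auto simp: decision_hists_def)
qed simp

lemma own_record_eq:
  assumes "h \<in> info G i" "x \<in> h" "y \<in> h"
  shows "own_record G i x = own_record G i y"
  using multistage assms unfolding multistage_form_def perfect_recall_def by blast

lemma length_info:
  assumes "h \<in> info G i" "x \<in> h" "y \<in> h"
  shows "length (snd x) = length (snd y)"
  using multistage assms unfolding multistage_form_def stage_def by (metis add_right_imp_eq)

lemma info_record:
  assumes "h \<in> info G i" "x \<in> h" "y \<in> h" "k < length (snd x)"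
  shows "info_of G i (fst x, take k (snd x)) = info_of G i (fst y, take k (snd y))"
    and "(snd x ! k) i = (snd y ! k) i"
proof -
  have "own_record G i x ! k = own_record G i y ! k" using own_record_eq[OF assms(1-3)] by simp
  then show "info_of G i (fst x, take k (snd x)) = info_of G i (fst y, take k (snd y))"
    and "(snd x ! k) i = (snd y ! k) i"
    using assms(4) length_info[OF assms(1-3)] by (auto simp: own_record_def)
qed

text \<open>The two claims need each other. Definedness at earlier stages makes the next information
  set allowed, and definedness there makes the next profile feasible.\<close>

lemma play_mem:
  assumes "\<And>j. \<sigma> j \<in> strategies G j" "\<theta> \<in> nature G" "k \<le> horizon G"
  shows "play G \<sigma> \<theta> k \<in> hists G \<and> (\<forall>m<k. \<forall>j. info_of G j (play G \<sigma> \<theta> m) \<in> dom (\<sigma> j))"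
  using assms(3)
proof (induction k)
  case 0
  then show ?case using multistage assms(2) by (simp add: multistage_form_def)
next
  case (Suc k)
  let ?x = "play G \<sigma> \<theta> k"
  have d: "?x \<in> decision_hists G" using Suc by (simp add: decision_hists_def)
  have dom: "info_of G j ?x \<in> dom (\<sigma> j)" for j
  proof -
    have "\<sigma> j h' = Some a" if "(h', a) \<in> set (own_record G j ?x)" for h' a
      using that Suc by (fastforce simp: own_record_play domIff)
    then have "\<forall>(h', a) \<in> set (own_record G j ?x). \<sigma> j h' = Some a"
      by (simp add: case_prod_beta)
    then have "info_of G j ?x \<in> allowed G j (\<sigma> j)"
      unfolding allowed_def using info_of_mem[OF d] by blast
    then show ?thesis using assms(1) by (simp add: strategies_def)
  qed
  have "the (\<sigma> j (info_of G j ?x)) \<in> avail G j (info_of G j ?x)" for j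
  proof -
    obtain a where "\<sigma> j (info_of G j ?x) = Some a" using dom by blast
    then show ?thesis using assms(1)[of j] by (simp add: strategies_def)
  qed
  then have "(\<theta>, snd ?x @ [\<lambda>j. the (\<sigma> j (info_of G j ?x))]) \<in> hists G"
    unfolding hists_snoc play_eq_pair using d by simp
  then show ?case using Suc dom by (auto simp: less_Suc_eq)
qed

lemma play_decision:
  assumes "\<And>j. \<sigma> j \<in> strategies G j" "\<theta> \<in> nature G" "k < horizon G"
  shows "play G \<sigma> \<theta> k \<in> decision_hists G"
  using play_mem[of \<sigma> \<theta> k] assms by (simp add: decision_hists_def)

lemma play_defined:
  assumes "\<And>j. \<sigma> j \<in> strategies G j" "\<theta> \<in> nature G" "k < horizon G"
  shows "info_of G j (play G \<sigma> \<theta> k) \<in> dom (\<sigma> j)"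
  using play_mem[of \<sigma> \<theta> "Suc k"] assms by auto

lemma reduced_strategy:
  assumes "\<And>h. h \<in> info G i \<Longrightarrow> f h \<in> avail G i h"
  shows "reduced G i f \<in> strategies G i"
proof -
  \<comment> \<open>An information set on the record of \<open>x\<close> contains a prefix of
    \<open>x\<close>. The record of that prefix is a prefix of the record of \<open>x\<close> and
    hence agrees with \<open>f\<close> as well.\<close>
  have consistent: "reduced G i f h' = Some a"
    if h: "h \<in> info G i" "x \<in> h" "\<forall>(h', a) \<in> set (own_record G i x). f h' = a"
      and r: "(h', a) \<in> set (own_record G i x)" for h x h' a
  proof -
    obtain k where k: "k < length (snd x)" "h' = info_of G i (fst x, take k (snd x))"
      using r by (auto simp: own_record_def)
    let ?y = "(fst x, take k (snd x))"
    have "(fst x, snd x) \<in> hists G" using info_decision[OF h(1,2)] by (simp add: decision_hists_def)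
    then have y: "?y \<in> decision_hists G" using hists_take k(1) by blast
    have "own_record G i ?y = take k (own_record G i x)"
      using k(1) by (intro nth_equalityI) (simp_all add: own_record_def min_absorb1)
    then have sub: "set (own_record G i ?y) \<subseteq> set (own_record G i x)"
      by (simp add: set_take_subset)
    have "\<forall>(h', a) \<in> set (own_record G i ?y). f h' = a"
      by (intro ballI bspec[OF h(3)] subsetD[OF sub])
    moreover have "f h' = a" using bspec[OF h(3) r] by simp
    ultimately show ?thesis using info_of_mem[OF y] k(2) by (auto simp: reduced_def)
  qed
  have val: "h \<in> info G i \<and> f h = a" if "reduced G i f h = Some a" for h a
    using that by (simp add: reduced_def split: if_splits)
  have "dom (reduced G i f) \<subseteq> allowed G i (reduced G i f)"
  proof
    fix h assume "h \<in> dom (reduced G i f)"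
    then obtain x where h: "h \<in> info G i" "x \<in> h" "\<forall>(h', a) \<in> set (own_record G i x). f h' = a"
      by (auto simp: reduced_def split: if_splits)
    have "\<forall>(h', a) \<in> set (own_record G i x). reduced G i f h' = Some a"
      using consistent[OF h] by (simp add: case_prod_beta)
    then show "h \<in> allowed G i (reduced G i f)" using h(1,2) unfolding allowed_def by blast
  qed
  moreover have "allowed G i (reduced G i f) \<subseteq> dom (reduced G i f)"
  proof
    fix h assume "h \<in> allowed G i (reduced G i f)"
    then obtain x where h: "h \<in> info G i" "x \<in> h"
      "\<forall>(h', a) \<in> set (own_record G i x). reduced G i f h' = Some a"
      unfolding allowed_def by blast
    have "\<forall>(h', a) \<in> set (own_record G i x). f h' = a"
      using h(3) val by (simp add: case_prod_beta)
    then have "reduced G i f h = Some (f h)" using h(1,2) unfolding reduced_def by auto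
    then show "h \<in> dom (reduced G i f)" by blast
  qed
  moreover have "a \<in> avail G i h" if "reduced G i f h = Some a" for h a
    using val[OF that] assms by blast
  ultimately show ?thesis unfolding strategies_def by blast
qed

lemma reduced_play:
  assumes "\<And>j. \<sigma> j \<in> strategies G j" "\<theta> \<in> nature G" "k < horizon G" "\<sigma> i = reduced G i f"
  shows "the (\<sigma> i (info_of G i (play G \<sigma> \<theta> k))) = f (info_of G i (play G \<sigma> \<theta> k))"
proof -
  have "info_of G i (play G \<sigma> \<theta> k) \<in> dom (reduced G i f)"
    using play_defined[of \<sigma> \<theta> k i] assms by simp
  then show ?thesis
    unfolding assms(4) by (simp add: reduced_eq)
qed

section \<open>Runs of one strategy against fixed opponents\<close>

definition path where
  "path i s t k = play G ((snd t)(i := s)) (fst t) k"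

lemma profile_strategies:
  assumes "t \<in> opponents G i" "s \<in> strategies G i"
  shows "((snd t)(i := s)) j \<in> strategies G j" "fst t \<in> nature G"
proof -
  have t: "snd t \<in> (\<Pi>\<^sub>E j\<in>UNIV - {i}. strategies G j)" and "fst t \<in> nature G"
    using assms(1) by (simp_all add: opponents_def mem_Times_iff)
  then show "fst t \<in> nature G" by simp
  show "((snd t)(i := s)) j \<in> strategies G j"
    using assms(2) PiE_mem[OF t, of j] by (cases "j = i") simp_all
qed

lemma zeta_path: "zeta G i s t = path i s t (horizon G)"
  by (simp add: zeta_def path_def)

lemma path_decision:
  assumes "t \<in> opponents G i" "s \<in> strategies G i" "k < horizon G"
  shows "path i s t k \<in> decision_hists G"
  unfolding path_def using profile_strategies[OF assms(1,2)] assms(3) by (intro play_decision) auto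

lemma path_defined:
  assumes "t \<in> opponents G i" "s \<in> strategies G i" "k < horizon G"
  shows "s (info_of G i (path i s t k)) \<noteq> None"
  using play_defined[of "(snd t)(i := s)" "fst t" k i] profile_strategies[OF assms(1,2)] assms(3)
  by (auto simp: path_def)

lemma info_prec_zeta:
  assumes "h \<in> info G i"
  shows "info_prec h {zeta G j s t} \<longleftrightarrow> (\<exists>k<horizon G. path j s t k \<in> h)"
proof
  assume "info_prec h {zeta G j s t}"
  then obtain x where x: "x \<in> h" "hist_prec x (path j s t (horizon G))"
    by (auto simp: info_prec_def zeta_path)
  let ?k = "length (snd x)"
  have k: "?k < horizon G" using info_decision[OF assms x(1)] by (simp add: decision_hists_def)
  have "snd x = take ?k (snd (path j s t (horizon G)))"
    using x(2) by (auto simp: hist_prec_def strict_prefix_def prefix_def)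
  then have "x = path j s t ?k"
    using x(2) k by (auto simp: hist_prec_def path_def take_play prod_eq_iff)
  then show "\<exists>k<horizon G. path j s t k \<in> h" using k x(1) by auto
next
  assume "\<exists>k<horizon G. path j s t k \<in> h"
  then obtain k where k: "k < horizon G" "path j s t k \<in> h" by auto
  have "strict_prefix (snd (path j s t k)) (snd (path j s t (horizon G)))"
    unfolding path_def using k(1) take_is_prefix[of k "snd (play G ((snd t)(j := s)) (fst t) (horizon G))"]
    by (auto simp: take_play strict_prefix_def dest: arg_cong[of _ _ length])
  then have "hist_prec (path j s t k) (zeta G j s t)"
    by (simp add: hist_prec_def zeta_path) (simp add: path_def)
  then show "info_prec h {zeta G j s t}" using k(2) by (auto simp: info_prec_def)
qed

lemma strats_at_iff:
  assumes "h \<in> info G i"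
  shows "s \<in> strats_at G i h \<longleftrightarrow>
    s \<in> strategies G i \<and> (\<exists>t\<in>opponents G i. \<exists>k<horizon G. path i s t k \<in> h)"
  by (simp add: strats_at_def info_prec_zeta[OF assms])

lemma opps_at_iff:
  assumes "h \<in> info G i"
  shows "t \<in> opps_at G i h \<longleftrightarrow>
    t \<in> opponents G i \<and> (\<exists>s\<in>strategies G i. \<exists>k<horizon G. path i s t k \<in> h)"
  by (simp add: opps_at_def info_prec_zeta[OF assms])

lemma length_path [simp]: "length (snd (path i s t k)) = k"
  by (simp add: path_def)

lemma path_Suc:
  "path i s t (Suc k) = (fst t, snd (path i s t k) @
     [\<lambda>j. the (((snd t)(i := s)) j (info_of G j (path i s t k)))])"
  by (simp add: path_def)

text \<open>Perfect recall makes reaching \<open>h\<close> a property of \<open>s\<close> and \<open>t\<close> separately.\<close>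

lemma path_unique:
  assumes h: "h \<in> info G i" and s: "path i s t' n \<in> h" and s': "path i s' t n \<in> h"
  shows "m \<le> n \<Longrightarrow> path i s t m = path i s' t m"
proof (induction m)
  case 0
  then show ?case by (simp add: path_def)
next
  case (Suc m)
  let ?x = "path i s t' n" and ?y = "path i s' t n"
  have x: "(fst ?x, take m (snd ?x)) = path i s t' m" and y: "(fst ?y, take m (snd ?y)) = path i s' t m"
    using Suc by (auto simp: path_def take_play prod_eq_iff)
  have i: "info_of G i (path i s t' m) = info_of G i (path i s' t m)"
    using info_record(1)[OF h s s', of m] x y Suc by simp
  have "(snd ?x ! m) i = (snd ?y ! m) i"
    using info_record(2)[OF h s s', of m] Suc by simp
  then have "the (s (info_of G i (path i s t' m))) = the (s' (info_of G i (path i s' t m)))"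
    using Suc by (simp add: path_def nth_play)
  then have "the (((snd t)(i := s)) j (info_of G j (path i s t m)))
      = the (((snd t)(i := s')) j (info_of G j (path i s' t m)))" for j
    using Suc i by simp
  then show ?case using Suc by (simp add: path_Suc)
qed

lemma path_hits:
  assumes "h \<in> info G i" "s \<in> strats_at G i h" "t \<in> opps_at G i h" "x \<in> h"
  shows "path i s t (length (snd x)) \<in> h"
proof -
  obtain t' k where 1: "path i s t' k \<in> h" using assms(1,2) by (auto simp: strats_at_iff)
  obtain s' k' where 2: "path i s' t k' \<in> h" using assms(1,3) by (auto simp: opps_at_iff)
  have "k = length (snd x)" "k' = length (snd x)"
    using length_info[OF assms(1) 1 assms(4)] length_info[OF assms(1) 2 assms(4)] by simp_all
  then show ?thesis using path_unique[OF assms(1), of s t' k s' t k] 1 2 by simp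
qed

text \<open>\<open>info_prec\<close> supplies just one pair of histories. Perfect recall transfers
  it to whichever history of \<open>h\<close> the run actually reaches.\<close>

lemma info_prec_path:
  assumes "k \<in> info G i" "h \<in> info G i" "info_prec k h" "path i s t m \<in> h"
    "s \<in> strategies G i" "t \<in> opponents G i"
  shows "\<exists>j<m. path i s t j \<in> k"
proof -
  obtain x y where x: "x \<in> k" and y: "y \<in> h" and xy: "hist_prec x y"
    using assms(3) by (auto simp: info_prec_def)
  let ?j = "length (snd x)"
  have l: "length (snd y) = m" using length_info[OF assms(2) y assms(4)] by simp
  have j: "?j < m" using xy l by (auto simp: hist_prec_def strict_prefix_def prefix_def)
  have "snd x = take ?j (snd y)"
    using xy by (auto simp: hist_prec_def strict_prefix_def prefix_def)
  then have "x = (fst y, take ?j (snd y))" using xy by (simp add: hist_prec_def prod_eq_iff)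
  then have "k = info_of G i (fst y, take ?j (snd y))" using info_of_eq[OF assms(1) x] by simp
  also have "\<dots> = info_of G i (path i s t ?j)"
    using info_record(1)[OF assms(2) y assms(4), of ?j] j l by (simp add: path_def take_play play_eq_pair)
  finally have "k = info_of G i (path i s t ?j)" .
  moreover have "m < horizon G" using info_decision[OF assms(2,4)] by (simp add: decision_hists_def)
  then have "path i s t ?j \<in> decision_hists G" using path_decision assms(5,6) j by simp
  ultimately have "path i s t ?j \<in> k" using info_of_mem(2) by metis
  then show ?thesis using j by blast
qed

end

section \<open>The mechanism\<close>

lemma ex_strict_linear_order: "\<exists>r :: 'o::finite rel. strict_linear_order r"
proof -
  obtain f :: "'o \<Rightarrow> nat" where f: "inj f" using finite_imp_inj_to_nat_seg[OF finite_UNIV] by blast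
  have "strict_linear_order {(x, y). f x < f y}"
    using f by (auto simp: strict_linear_order_on_def trans_def irrefl_def total_on_def inj_def)
      (metis nat_neq_iff)
  then show ?thesis by blast
qed

context pointing
begin

definition cell :: "'i \<Rightarrow> ('i \<Rightarrow> 'a) list \<Rightarrow> ('i \<Rightarrow> 'a) list set" where
  "cell i as = {bs. feasible bs \<and> length bs < card (UNIV :: 'i set) \<and> obs i bs = obs i as}"

definition infoset :: "'i \<Rightarrow> 'o rel \<Rightarrow> ('i \<Rightarrow> 'a) list \<Rightarrow> ('i, 'i \<Rightarrow> 'o rel, 'a) hist set" where
  "infoset i r as = {\<theta> \<in> profiles. \<theta> i = r} \<times> cell i as"

text \<open>Any representative of a cell yields the same menu, by \<open>obs_free\<close>. The final
  pointers give the allocation because assigned agents keep repeating the action with which they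
  left.\<close>

definition ttc_mech :: "('i \<Rightarrow> 'o) \<Rightarrow> ('i, 'a, 'o) mechanism" where
  "ttc_mech endow =
     \<lparr> rounds = card (UNIV :: 'i set),
       seqs = {as. feasible as \<and> length as \<le> card (UNIV :: 'i set)},
       cells = (\<lambda>i. {cell i as | as. feasible as \<and> length as < card (UNIV :: 'i set)}),
       menu = (\<lambda>i c. options i (SOME as. as \<in> c)),
       alloc = (\<lambda>as i. endow (target (last as i))) \<rparr>"

lemma infoset_cong: "obs i as = obs i bs \<Longrightarrow> infoset i r as = infoset i r bs"
  by (simp add: infoset_def cell_def)

lemma mem_infoset:
  "(\<theta>, bs) \<in> infoset i r as \<longleftrightarrow>
     \<theta> \<in> profiles \<and> \<theta> i = r \<and> feasible bs \<and> length bs < card (UNIV :: 'i set) \<and> obs i bs = obs i as"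
  by (auto simp: infoset_def cell_def)

end

text \<open>Stated for a record scheme, so that the results apply both to the form of the mechanism
  and to the induced game, which extends it by outcomes and payoffs.\<close>

locale ttc_rules = pointing target Acts
  for target :: "'a \<Rightarrow> 'i::finite" and Acts +
  fixes G :: "('i, 'i \<Rightarrow> 'o::finite rel, 'a, 'z) game_form_scheme"
  assumes nature: "nature G = profiles"
    and horizon: "horizon G = card (UNIV :: 'i set)"
    and hists: "hists G = profiles \<times> {as. feasible as \<and> length as \<le> card (UNIV :: 'i set)}"
    and info: "info G i =
      {infoset i r as | r as. r \<in> rankings \<and> feasible as \<and> length as < card (UNIV :: 'i set)}"
    and avail: "r \<in> rankings \<Longrightarrow> feasible as \<Longrightarrow> length as < card (UNIV :: 'i set) \<Longrightarrow>
      avail G i (infoset i r as) = options i as"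
begin

lemma decision_hists:
  "decision_hists G = profiles \<times> {as. feasible as \<and> length as < card (UNIV :: 'i set)}"
  by (auto simp: decision_hists_def hists horizon)

lemma info_infoset:
  assumes "h \<in> info G i" "(\<theta>, as) \<in> h"
  shows "h = infoset i (\<theta> i) as"
  using assms by (auto simp: info mem_infoset intro!: infoset_cong)

lemma infoset_info:
  "(\<theta>, as) \<in> decision_hists G \<Longrightarrow> infoset i (\<theta> i) as \<in> info G i"
  by (auto simp: info decision_hists profiles_def)

lemma mem_own_infoset:
  "(\<theta>, as) \<in> decision_hists G \<Longrightarrow> (\<theta>, as) \<in> infoset i (\<theta> i) as"
  by (auto simp: decision_hists mem_infoset)

lemma info_of_infoset:
  assumes "(\<theta>, as) \<in> decision_hists G"
  shows "info_of G i (\<theta>, as) = infoset i (\<theta> i) as"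
  unfolding info_of_def
  using infoset_info[OF assms] mem_own_infoset[OF assms] info_infoset
  by (intro the_equality) auto

lemma avail_infoset:
  "(\<theta>, as) \<in> decision_hists G \<Longrightarrow> avail G i (infoset i (\<theta> i) as) = options i as"
  by (simp add: decision_hists profiles_def avail)

lemma profiles_nonempty:
  assumes "r \<in> rankings"
  shows "\<exists>\<theta>\<in>profiles. \<theta> i = r"
  using assms by (intro bexI[of _ "\<lambda>_. r"]) (auto simp: profiles_def)

lemma info_partition: "partition_on (decision_hists G) (info G i)"
proof (rule partition_onI)
  have "h \<noteq> {}" if hi: "h \<in> info G i" for h
  proof -
    obtain r as where h: "h = infoset i r as" "r \<in> rankings" "feasible as" "length as < card (UNIV :: 'i set)"
      using hi by (auto simp: info)
    obtain \<theta> where "\<theta> \<in> profiles" "\<theta> i = r" using profiles_nonempty[OF h(2), of i] by auto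
    then have "(\<theta>, as) \<in> h" using h by (simp add: mem_infoset)
    then show ?thesis by blast
  qed
  then show "{} \<notin> info G i" by blast
next
  fix h h' assume hh: "h \<in> info G i" "h' \<in> info G i" "h \<noteq> h'"
  show "disjnt h h'"
    unfolding disjnt_iff
  proof
    fix x :: "('i, 'i \<Rightarrow> 'o rel, 'a) hist"
    obtain \<theta> as where x: "x = (\<theta>, as)" by (cases x)
    show "\<not> (x \<in> h \<and> x \<in> h')"
      using info_infoset[OF hh(1), of \<theta> as] info_infoset[OF hh(2), of \<theta> as] hh(3) x by blast
  qed
next
  show "\<Union> (info G i) = decision_hists G"
  proof
    show "\<Union> (info G i) \<subseteq> decision_hists G" by (auto simp: info mem_infoset decision_hists)
    show "decision_hists G \<subseteq> \<Union> (info G i)"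
    proof
      fix x assume "x \<in> decision_hists G"
      then show "x \<in> \<Union> (info G i)"
        using infoset_info[of "fst x" "snd x" i] mem_own_infoset[of "fst x" "snd x" i]
        by (intro UnionI[of "infoset i (fst x i) (snd x)"]) simp_all
    qed
  qed
qed

lemma hist_take: "(\<theta>, as) \<in> decision_hists G \<Longrightarrow> (\<theta>, take k as) \<in> decision_hists G"
  by (auto simp: decision_hists feasible_take)

lemma multistage_form: "multistage_form G"
proof -
  have f1: "finite (profiles :: ('i \<Rightarrow> 'o rel) set)" by simp
  have f2: "(profiles :: ('i \<Rightarrow> 'o rel) set) \<noteq> {}"
  proof -
    obtain r :: "'o rel" where "r \<in> rankings" using ex_strict_linear_order by (auto simp: rankings_def)
    then show ?thesis using profiles_nonempty[of r undefined] by blast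
  qed
  have f3: "card (UNIV :: 'i set) \<ge> 1" by (simp add: Suc_leI card_gt_0_iff)
  have f4: "(\<theta>, []) \<in> hists G \<longleftrightarrow> \<theta> \<in> profiles" for \<theta> by (simp add: hists nature)
  have f5: "(\<theta>, as @ [p]) \<in> hists G \<longleftrightarrow>
      (\<theta>, as) \<in> decision_hists G \<and> (\<forall>i. p i \<in> avail G i (info_of G i (\<theta>, as)))" for \<theta> as p
  proof (cases "(\<theta>, as) \<in> decision_hists G")
    case True
    then show ?thesis
      by (simp add: info_of_infoset avail_infoset) (auto simp: hists decision_hists feasible_snoc)
  qed (auto simp: hists decision_hists feasible_snoc)
  have f6: "stage x = stage y" if hi: "h \<in> info G i" "x \<in> h" "y \<in> h" for i h x y
  proof -
    obtain r as where "h = infoset i r as" using hi unfolding info by blast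
    then have "obs i (snd x) = obs i as" "obs i (snd y) = obs i as"
      using that(2,3) mem_infoset[of "fst x" "snd x" i r as] mem_infoset[of "fst y" "snd y" i r as]
      by simp_all
    then show ?thesis using obs_length[of i "snd x" "snd y"] by (simp add: stage_def)
  qed
  have f7: "finite (avail G i h)" and f8: "avail G i h \<noteq> {}" if hi: "h \<in> info G i" for i h
  proof -
    obtain r as where "h = infoset i r as" "r \<in> rankings" "feasible as" "length as < card (UNIV :: 'i set)"
      using hi unfolding info by blast
    then show "finite (avail G i h)" "avail G i h \<noteq> {}" by (simp_all add: avail options_finite options_nonempty)
  qed
  have f9: "perfect_recall G"
    unfolding perfect_recall_def
  proof (intro allI ballI)
    fix i h x y assume h: "h \<in> info G i" "x \<in> h" "y \<in> h"
    obtain \<theta> as where x: "x = (\<theta>, as)" by (cases x)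
    obtain \<theta>' bs where y: "y = (\<theta>', bs)" by (cases y)
    have d: "(\<theta>, as) \<in> decision_hists G" "(\<theta>', bs) \<in> decision_hists G"
      using h x y info_partition[of i] by (auto simp: partition_on_def)
    have "h = infoset i (\<theta> i) as" using info_infoset h x by simp
    then have o: "\<theta>' i = \<theta> i" "obs i bs = obs i as" using h(3) y by (auto simp: mem_infoset)
    have r: "info_of G i (\<theta>, take k as) = info_of G i (\<theta>', take k bs)" for k
      unfolding info_of_infoset[OF hist_take[OF d(1)]] info_of_infoset[OF hist_take[OF d(2)]]
      using infoset_cong[OF obs_take[OF o(2), of k], of "\<theta> i"] o(1) by simp
    show "own_record G i x = own_record G i y"
      unfolding own_record_def x y fst_conv snd_conv
    proof (rule map_cong)
      show "[0..<length as] = [0..<length bs]" using obs_length[OF o(2)] by simp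
      show "(info_of G i (\<theta>, take k as), (as ! k) i) = (info_of G i (\<theta>', take k bs), (bs ! k) i)"
        if "k \<in> set [0..<length bs]" for k
        using obs_nth[OF o(2), of k] that r by simp
    qed
  qed
  show ?thesis
    unfolding multistage_form_def nature horizon
    by (intro conjI allI ballI)
      (rule f1 f2 f3 f4 f5 f9 info_partition | (rule f6 f7 f8; assumption))+
qed

sublocale multistage G
  by unfold_locales (rule multistage_form)

lemma path_infoset:
  assumes "t \<in> opponents G i" "s \<in> strategies G i" "k < horizon G"
  shows "info_of G j (path i s t k) = infoset j (fst t j) (snd (path i s t k))"
  using info_of_infoset[of "fst t" "snd (path i s t k)" j] path_decision[OF assms]
  by (simp add: path_def play_eq_pair)

lemma path_feasible:
  assumes "t \<in> opponents G i" "s \<in> strategies G i" "k \<le> horizon G"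
  shows "feasible (snd (path i s t k))"
proof -
  have "path i s t k \<in> hists G"
    unfolding path_def using play_mem[OF profile_strategies[OF assms(1,2)] assms(3)] by blast
  then show ?thesis by (auto simp: hists)
qed

lemma path_nth_own:
  assumes "t \<in> opponents G i" "s \<in> strategies G i" "k < m" "m \<le> horizon G"
  shows "(snd (path i s t m) ! k) i = the (s (infoset i (fst t i) (snd (path i s t k))))"
  using path_infoset[OF assms(1,2), of k i] assms by (simp add: path_def nth_play)

lemma path_nth_other:
  assumes "t \<in> opponents G i" "s \<in> strategies G i" "k < m" "m \<le> horizon G" "j \<noteq> i"
  shows "(snd (path i s t m) ! k) j = the (snd t j (infoset j (fst t j) (snd (path i s t k))))"
  using path_infoset[OF assms(1,2), of k j] assms by (simp add: path_def nth_play)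

lemma take_path: "m \<le> k \<Longrightarrow> take m (snd (path i s t k)) = snd (path i s t m)"
  by (simp add: path_def take_play)

lemma fst_path [simp]: "fst (path i s t k) = fst t"
  by (simp add: path_def)

end

lemma (in pointing) ttc_mech_rules:
  "ttc_rules target Acts (mech_form (ttc_mech endow :: ('i, 'a, 'o::finite) mechanism))"
proof
  let ?M = "ttc_mech endow :: ('i, 'a, 'o) mechanism"
  let ?G = "mech_form ?M"
  show "nature ?G = profiles" "horizon ?G = card (UNIV :: 'i set)"
    "hists ?G = profiles \<times> {as. feasible as \<and> length as \<le> card (UNIV :: 'i set)}"
    by (simp_all add: mech_form_def ttc_mech_def)
  show "info ?G i =
      {infoset i r as | r as. r \<in> rankings \<and> feasible as \<and> length as < card (UNIV :: 'i set)}" for i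
    by (auto simp: mech_form_def ttc_mech_def infoset_def)
  show "avail ?G i (infoset i r as) = options i as"
    if "r \<in> rankings" "feasible as" "length as < card (UNIV :: 'i set)" for i and r :: "'o rel" and as
  proof -
    \<comment> \<open>The projection recovers the cell only if the set of profiles in the product is
      nonempty; the constant profile is a witness.\<close>
    have "(\<lambda>_. r) \<in> {\<theta> \<in> profiles. \<theta> i = r}" using that(1) by (simp add: profiles_def)
    then have "snd ` infoset i r as = cell i as" unfolding infoset_def snd_image_times by (simp only: empty_iff if_False split: if_split) blast
    moreover have "as \<in> cell i as" using that by (simp add: cell_def)
    then have "(SOME bs. bs \<in> cell i as) \<in> cell i as" by (rule someI)
    then have "obs i (SOME bs. bs \<in> cell i as) = obs i as" unfolding cell_def by blast
    then have "options i (SOME bs. bs \<in> cell i as) = options i as" by (rule obs_free(2))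
    ultimately show ?thesis by (simp add: mech_form_def ttc_mech_def)
  qed
qed

lemma (in pointing) ttc_mech_is_mechanism:
  fixes endow :: "'i \<Rightarrow> 'o::finite"
  assumes "bij endow"
  shows "is_mechanism (ttc_mech endow)"
proof -
  interpret ttc_rules target Acts "mech_form (ttc_mech endow)" by (rule ttc_mech_rules)
  have "bij (alloc (ttc_mech endow) as)"
    if "feasible as" "length as = card (UNIV :: 'i set)" for as
    using bij_comp[OF bij_target_last[OF that] assms] by (simp add: ttc_mech_def comp_def)
  then show ?thesis
    using multistage_form by (auto simp: is_mechanism_def ttc_mech_def)
qed

lemma (in pointing) induced_rules:
  "ttc_rules target Acts (induced_game (ttc_mech endow :: ('i, 'a, 'o::finite) mechanism) v)"
proof -
  interpret ttc_rules target Acts "mech_form (ttc_mech endow)" by (rule ttc_mech_rules)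
  show ?thesis
    by unfold_locales (simp_all add: induced_game_def nature horizon hists info avail)
qed

section \<open>Copying a run that is only imagined\<close>

context ttc_rules
begin

text \<open>The own actions that \<open>s\<close> would have taken had the sets of remaining agents been \<open>R\<close>, where
  after an assignment in this imagined run the last action is repeated as long as its target
  remains.\<close>

primrec virtual_record :: "('i, 'i \<Rightarrow> 'o rel, 'a) strat \<Rightarrow> 'i \<Rightarrow> 'o rel \<Rightarrow> (nat \<Rightarrow> 'i set) \<Rightarrow> nat \<Rightarrow> 'a list"
where
  "virtual_record s i r R 0 = []"
| "virtual_record s i r R (Suc k) = virtual_record s i r R k @
     [if 0 < k \<and> target (last (virtual_record s i r R k)) \<in> R k
      then last (virtual_record s i r R k)
      else the (s ({\<theta> \<in> profiles. \<theta> i = r} \<times> {bs. feasible bs \<and> length bs < card (UNIV :: 'i set) \<and>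
        obs i bs = (virtual_record s i r R k, map R [0..<Suc k])}))]"

text \<open>The action imagined after \<open>k\<close> rounds. The imagined run has own actions and
  removals but no full action profiles, which is why \<open>virtual_record\<close> specifies its
  information sets by an observation instead of a representative sequence.\<close>

definition virtual :: "('i, 'i \<Rightarrow> 'o rel, 'a) strat \<Rightarrow> 'i \<Rightarrow> 'o rel \<Rightarrow> (nat \<Rightarrow> 'i set) \<Rightarrow> nat \<Rightarrow> 'a" where
  "virtual s i r R k = last (virtual_record s i r R (Suc k))"

definition copy_action :: "('i, 'i \<Rightarrow> 'o rel, 'a) strat \<Rightarrow> 'i \<Rightarrow> ('i, 'i \<Rightarrow> 'o rel, 'a) hist set \<Rightarrow> 'a
    \<Rightarrow> ('i, 'i \<Rightarrow> 'o rel, 'a) hist set \<Rightarrow> 'a" where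
  "copy_action s i h a h' = (if h' = h then a else
     let x = SOME x. x \<in> h';
         b = virtual s i (fst x i) (\<lambda>k. remaining (take k (snd x))) (length (snd x))
     in if b \<in> avail G i h' then b else SOME b. b \<in> avail G i h')"

definition copy :: "('i, 'i \<Rightarrow> 'o rel, 'a) strat \<Rightarrow> 'i \<Rightarrow> ('i, 'i \<Rightarrow> 'o rel, 'a) hist set \<Rightarrow> 'a
    \<Rightarrow> ('i, 'i \<Rightarrow> 'o rel, 'a) strat" where
  "copy s i h a = reduced G i (copy_action s i h a)"

lemma virtual_record_cong:
  assumes "\<And>j. j < k \<Longrightarrow> R j = R' j"
  shows "virtual_record s i r R k = virtual_record s i r R' k"
  using assms
proof (induction k)
  case (Suc k)
  have m: "map R [0..<Suc k] = map R' [0..<Suc k]" using Suc(2) by (intro map_cong) auto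
  have "virtual_record s i r R k = virtual_record s i r R' k" using Suc by simp
  then show ?case unfolding virtual_record.simps m using Suc(2)[of k] by simp
qed simp

lemma virtual_cong: "(\<And>j. j \<le> k \<Longrightarrow> R j = R' j) \<Longrightarrow> virtual s i r R k = virtual s i r R' k"
  unfolding virtual_def by (intro arg_cong[where f = last] virtual_record_cong) simp

lemma virtual_repeat:
  assumes "0 < k" "target (virtual s i r R (k - 1)) \<in> R k"
  shows "virtual s i r R k = virtual s i r R (k - 1)"
  using assms by (simp add: virtual_def)

text \<open>If the last target remains, the agent is not free and the imagined repetition is the
  move forced on \<open>s\<close>. Otherwise the imagined observation is that of the real history,
  where \<open>s\<close> is consulted.\<close>

lemma virtual_record_path:
  assumes t: "t \<in> opponents G i" and s: "s \<in> strategies G i"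
    and X: "X = snd (path i s t (horizon G))"
  shows "k \<le> horizon G \<Longrightarrow> (\<And>j. j < k \<Longrightarrow> remaining (take j X) = R j) \<Longrightarrow>
    virtual_record s i (fst t i) R k = map (\<lambda>p. p i) (take k X)"
proof (induction k)
  case (Suc k)
  have k: "k < horizon G" and len: "length X = horizon G" using Suc(2) X by simp_all
  have IH: "virtual_record s i (fst t i) R k = map (\<lambda>p. p i) (take k X)" using Suc by simp
  have "map R [0..<Suc k] = map (\<lambda>j. remaining (take j (take k X))) [0..<Suc (length (take k X))]"
    using Suc(3) k len by (intro map_cong) (auto simp: min_absorb1)
  then have o: "(virtual_record s i (fst t i) R k, map R [0..<Suc k]) = obs i (take k X)"
    by (simp only: obs_def IH)
  have feas: "feasible X" using path_feasible[OF t s] X by simp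
  have own: "(X ! k) i = the (s (infoset i (fst t i) (take k X)))"
    unfolding X using path_nth_own[OF t s k order.refl] k by (simp add: take_path)
  have rep: "(X ! k) i = last (map (\<lambda>p. p i) (take k X))"
    if "0 < k" "target (last (map (\<lambda>p. p i) (take k X))) \<in> R k"
  proof -
    have "take k X \<noteq> []" using that(1) k len by auto
    then have l: "last (map (\<lambda>p. p i) (take k X)) = last (take k X) i" by (simp add: last_map)
    have l': "last (take k X) = X ! (k - 1)" using last_take[OF that(1), of X] k len by simp
    have "\<not> free i (take k X)"
      using that(2) l Suc(3)[of k] \<open>take k X \<noteq> []\<close> by (simp add: free_def)
    then have "(X ! k) i = (X ! (k - 1)) i" using unfree_nth[OF feas that(1)] k len by simp
    then show ?thesis by (simp only: l l')
  qed
  then have "(if 0 < k \<and> target (last (map (\<lambda>p. p i) (take k X))) \<in> R k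
      then last (map (\<lambda>p. p i) (take k X))
      else the (s (infoset i (fst t i) (take k X)))) = (X ! k) i"
    by (auto simp: own[symmetric])
  then have "virtual_record s i (fst t i) R (Suc k) = map (\<lambda>p. p i) (take k X) @ [(X ! k) i]"
    unfolding virtual_record.simps o infoset_def cell_def unfolding IH by (simp only:)
  then show ?case using k len by (simp del: virtual_record.simps add: take_Suc_conv_app_nth)
qed simp

lemma virtual_path:
  assumes "t \<in> opponents G i" "s \<in> strategies G i" "X = snd (path i s t (horizon G))"
    "k < horizon G" "\<And>j. j \<le> k \<Longrightarrow> remaining (take j X) = R j"
  shows "virtual s i (fst t i) R k = (X ! k) i"
proof -
  have "virtual_record s i (fst t i) R (Suc k) = map (\<lambda>p. p i) (take (Suc k) X)"
    using assms by (intro virtual_record_path) auto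
  moreover have "length X = horizon G" using assms(3) by simp
  ultimately show ?thesis using assms(4) by (simp only: virtual_def) (simp add: take_Suc_conv_app_nth)
qed

lemma copy_action_infoset:
  assumes "(\<theta>, as) \<in> decision_hists G" "infoset i (\<theta> i) as \<noteq> h"
    "virtual s i (\<theta> i) (\<lambda>k. remaining (take k as)) (length as) \<in> options i as"
  shows "copy_action s i h a (infoset i (\<theta> i) as)
    = virtual s i (\<theta> i) (\<lambda>k. remaining (take k as)) (length as)"
proof -
  define x where "x = (SOME x. x \<in> infoset i (\<theta> i) as)"
  have "x \<in> infoset i (\<theta> i) as"
    unfolding x_def using mem_own_infoset[OF assms(1), of i] by (rule someI)
  then have r: "fst x i = \<theta> i" and o: "obs i (snd x) = obs i as"
    using mem_infoset[of "fst x" "snd x" i "\<theta> i" as] by simp_all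
  have "virtual s i (\<theta> i) (\<lambda>k. remaining (take k (snd x))) (length as)
      = virtual s i (\<theta> i) (\<lambda>k. remaining (take k as)) (length as)"
    using obs_remaining[OF o] obs_length[OF o] by (intro virtual_cong) simp
  then show ?thesis
    using assms(2,3) r obs_length[OF o] avail_infoset[OF assms(1), of i]
    by (simp add: copy_action_def Let_def flip: x_def)
qed

lemma copy_strategy:
  assumes "h \<in> info G i" "a \<in> avail G i h"
  shows "copy s i h a \<in> strategies G i"
  unfolding copy_def
proof (rule reduced_strategy)
  fix h' assume h': "h' \<in> info G i"
  have "avail G i h' \<noteq> {}" using multistage_form h' by (simp add: multistage_form_def)
  then have "(SOME b. b \<in> avail G i h') \<in> avail G i h'" by (simp add: some_in_eq)
  then show "copy_action s i h a h' \<in> avail G i h'"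
    using assms(2) by (simp add: copy_action_def Let_def)
qed

lemma copy_play:
  assumes "h \<in> info G i" "a \<in> avail G i h" "t \<in> opponents G i" "k < horizon G"
  shows "the (copy s i h a (info_of G i (path i (copy s i h a) t k)))
    = copy_action s i h a (info_of G i (path i (copy s i h a) t k))"
  using reduced_play[of "(snd t)(i := copy s i h a)" "fst t" k i "copy_action s i h a"]
    profile_strategies[OF assms(3) copy_strategy[OF assms(1,2)]] assms(4)
  by (simp add: path_def copy_def)

lemma strats_choosingD:
  assumes "s \<in> strats_choosing G i h a"
  shows "s \<in> strategies G i" "s \<in> strats_at G i h" "s h = Some a"
  using assms by (auto simp: strats_choosing_def strats_at_def)

lemma opps_atD: "t \<in> opps_at G i h \<Longrightarrow> t \<in> opponents G i"
  by (simp add: opps_at_def)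

text \<open>Along a run of \<open>s\<close> the virtual action is the real one and hence available.
  Before the stage of \<open>h\<close> the special clause for \<open>h\<close> does not interfere,
  so copying never steers the agent away from \<open>h\<close>.\<close>

lemma copy_before:
  assumes h: "h \<in> info G i" "x \<in> h" and s: "s \<in> strats_at G i h" and t: "t \<in> opps_at G i h"
    and a: "a \<in> avail G i h"
  shows "m \<le> length (snd x) \<Longrightarrow> path i (copy s i h a) t m = path i s t m"
proof (induction m)
  case 0
  then show ?case by (simp add: path_def)
next
  case (Suc m)
  let ?s' = "copy s i h a"
  have so: "s \<in> strategies G i" using s by (simp add: strats_at_def)
  have to: "t \<in> opponents G i" using opps_atD[OF t] .
  have "x \<in> decision_hists G" using info_decision[OF h] .
  then have m: "m < horizon G" using Suc(2) by (simp add: decision_hists_def)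
  define X where "X = snd (path i s t (horizon G))"
  have len: "length X = horizon G" by (simp add: X_def)
  have tX: "take m X = snd (path i s t m)" using m by (simp add: X_def take_path)
  have IH: "path i ?s' t m = path i s t m" using Suc by simp
  have d: "path i s t m \<in> decision_hists G" using path_decision[OF to so m] .
  have d': "(fst t, take m X) \<in> decision_hists G" using d tX by (simp add: path_def play_eq_pair)
  have inf: "info_of G i (path i s t m) = infoset i (fst t i) (take m X)"
    using path_infoset[OF to so m] tX by simp
  have ne: "infoset i (fst t i) (take m X) \<noteq> h"
  proof
    assume "infoset i (fst t i) (take m X) = h"
    then have "path i s t m \<in> h" using inf info_of_mem(2)[OF d] by metis
    then show False using length_info[OF h(1) _ h(2)] Suc(2) by fastforce
  qed
  have v: "virtual s i (fst t i) (\<lambda>k. remaining (take k (take m X))) (length (take m X)) = (X ! m) i"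
    using virtual_path[OF to so X_def m] m len by (simp add: min_absorb1)
  have "(X ! m) i \<in> options i (take m X)"
    using feasible_nth[of X m i] path_feasible[OF to so, of "horizon G"] m len by (simp add: X_def)
  then have "copy_action s i h a (infoset i (fst t i) (take m X)) = (X ! m) i"
    using copy_action_infoset[OF d' ne] v by simp
  moreover have "(X ! m) i = the (s (infoset i (fst t i) (take m X)))"
    using path_nth_own[OF to so m order.refl] tX by (simp add: X_def)
  ultimately have "the (?s' (info_of G i (path i s t m))) = the (s (info_of G i (path i s t m)))"
    using copy_play[OF h(1) a to m, of s] IH inf by simp
  then show ?case using IH unfolding path_Suc by (simp add: fun_eq_iff)
qed

lemma copy_choosing:
  assumes h: "h \<in> info G i" "x \<in> h" and s: "s \<in> strats_at G i h" and t: "t \<in> opps_at G i h"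
    and a: "a \<in> avail G i h"
  shows "copy s i h a \<in> strats_choosing G i h a"
proof -
  let ?s' = "copy s i h a" and ?n = "length (snd x)"
  have n: "?n < horizon G" using info_decision[OF h] by (simp add: decision_hists_def)
  have hit: "path i ?s' t ?n \<in> h" using path_hits[OF h(1) s t h(2)] copy_before[OF h s t a] by simp
  have st: "?s' \<in> strategies G i" using copy_strategy[OF h(1) a] .
  have to: "t \<in> opponents G i" using opps_atD[OF t] .
  have "?s' h \<noteq> None" using path_defined[OF to st n] info_of_eq[OF h(1) hit] by simp
  then have "?s' h = Some (copy_action s i h a h)" unfolding copy_def by (intro reduced_eq) blast
  then have "?s' h = Some a" by (simp add: copy_action_def)
  moreover have "?s' \<in> strats_at G i h" using strats_at_iff[OF h(1)] st to hit n by blast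
  ultimately show ?thesis by (simp add: strats_choosing_def)
qed

text \<open>An instance of \<open>simulation\<close>: both runs face the same \<open>t\<close>,
  whose strategies react only to observations. \<open>V\<close> is computed from the removals in
  \<open>Y\<close>, as these are what the copy sees.\<close>

lemma copy_follows:
  assumes h: "h \<in> info G i" "x \<in> h" and s: "s \<in> strats_at G i h" and t: "t \<in> opps_at G i h"
    and a: "a \<in> avail G i h" and free: "free i (snd x)"
    and k: "length (snd x) < k0" "k0 \<le> k" "k < horizon G" "free i (snd (path i (copy s i h a) t k0))"
  shows "(snd (path i (copy s i h a) t (horizon G)) ! k) i = (snd (path i s t (horizon G)) ! k) i"
proof -
  let ?s' = "copy s i h a"
  define n where "n = length (snd x)"
  define X where "X = snd (path i s t (horizon G))"
  define Y where "Y = snd (path i ?s' t (horizon G))"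
  define V where "V = virtual s i (fst t i) (\<lambda>k. remaining (take k Y))"
  have so: "s \<in> strategies G i" using s by (simp add: strats_at_def)
  have so': "?s' \<in> strategies G i" using copy_strategy[OF h(1) a] .
  have to: "t \<in> opponents G i" using opps_atD[OF t] .
  have tX: "take m X = snd (path i s t m)" if "m \<le> horizon G" for m using that by (simp add: X_def take_path)
  have tY: "take m Y = snd (path i ?s' t m)" if "m \<le> horizon G" for m using that by (simp add: Y_def take_path)
  have n: "n < horizon G" using k by (simp add: n_def)
  have hit: "path i s t n \<in> h" using path_hits[OF h(1) s t h(2)] by (simp add: n_def)
  have h_eq: "h = infoset i (fst t i) (snd (path i s t n))"
    using path_infoset[OF to so n, of i] info_of_eq[OF h(1) hit] by simp
  have "obs i (snd x) = obs i (snd (path i s t n))"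
    using h(2) mem_infoset[of "fst x" "snd x" i "fst t i" "snd (path i s t n)"] h_eq by simp
  then have "free i (snd (path i s t n))" using obs_free(1) free by metis
  then have "free i (take n X)" using tX n by simp
  then have iR: "i \<in> remaining (take n X)" by (simp add: free_def)
  have "(Y ! k) i = (X ! k) i"
  proof (rule simulation[where X = X and Y = Y and i = i and k = k
        and N = "horizon G" and n = n and V = V and ?k0.0 = k0])
    show "feasible X" "feasible Y" unfolding X_def Y_def using path_feasible to so so' by blast+
    show "length X = horizon G" "length Y = horizon G" by (simp_all add: X_def Y_def)
    show "take n X = take n Y" using tX tY n copy_before[OF h s t a, of n] by (simp add: n_def)
    show "i \<in> remaining (take n X)" by (rule iR)
    show "(X ! m) l = (Y ! m) l"
      if "m < horizon G" "l \<noteq> i" "obs l (take m X) = obs l (take m Y)" for m l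
    proof -
      have "obs l (snd (path i s t m)) = obs l (snd (path i ?s' t m))" using that tX tY by simp
      then have "infoset l (fst t l) (snd (path i s t m)) = infoset l (fst t l) (snd (path i ?s' t m))"
        by (rule infoset_cong)
      then show ?thesis
        using path_nth_other[OF to so that(1) order.refl that(2)]
          path_nth_other[OF to so' that(1) order.refl that(2)] by (simp add: X_def Y_def)
    qed
    show "V m = (X ! m) i" if "m < horizon G" "\<forall>j\<le>m. remaining (take j X) = remaining (take j Y)" for m
      unfolding V_def using virtual_path[OF to so X_def that(1)] that(2) by simp
    show "V m = V (m - 1)" if "0 < m" "m < horizon G" "target (V (m - 1)) \<in> remaining (take m Y)" for m
      using virtual_repeat[OF that(1)] that(3) unfolding V_def by simp
    show "(Y ! m) i = V m" if m: "n < m" "m < horizon G" "V m \<in> options i (take m Y)" for m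
    proof -
      have d: "path i ?s' t m \<in> decision_hists G" using path_decision[OF to so' m(2)] .
      have tm: "take m Y = snd (path i ?s' t m)" using tY m by simp
      have d': "(fst t, take m Y) \<in> decision_hists G" using d tm by (simp add: path_def play_eq_pair)
      have inf: "info_of G i (path i ?s' t m) = infoset i (fst t i) (take m Y)"
        using path_infoset[OF to so' m(2)] tm by simp
      have ne: "infoset i (fst t i) (take m Y) \<noteq> h"
      proof
        assume "infoset i (fst t i) (take m Y) = h"
        then have "path i ?s' t m \<in> h" using inf info_of_mem(2)[OF d] by metis
        then show False using length_info[OF h(1) _ h(2)] m(1) n_def by fastforce
      qed
      have len: "length (take m Y) = m" using m by (simp add: tm)
      have v: "virtual s i (fst t i) (\<lambda>k. remaining (take k (take m Y))) (length (take m Y)) = V m"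
        unfolding V_def len by (intro virtual_cong) (simp add: min_absorb1)
      have "copy_action s i h a (infoset i (fst t i) (take m Y)) = V m"
        using copy_action_infoset[OF d' ne] v m(3) by simp
      then show ?thesis
        using copy_play[OF h(1) a to m(2), of s] path_nth_own[OF to so' m(2) order.refl] inf tm
        by (simp add: Y_def)
    qed
    show "n < k0" "k0 \<le> k" "k < horizon G" using k by (simp_all add: n_def)
    show "free i (take k0 Y)" using k tY by simp
  qed
  then show ?thesis by (simp add: X_def Y_def)
qed


section \<open>Activity after an information set, and mimicking\<close>

lemma info_obs:
  assumes "h \<in> info G i" "x \<in> h" "y \<in> h"
  shows "fst x i = fst y i" "obs i (snd x) = obs i (snd y)"
  using assms(2,3) info_infoset[OF assms(1), of "fst x" "snd x"]
    mem_infoset[of "fst y" "snd y" i "fst x i" "snd x"] by simp_all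

lemma options_avail:
  assumes "h \<in> info G i" "x \<in> h"
  shows "avail G i h = options i (snd x)"
  using avail_infoset[of "fst x" "snd x" i] info_infoset[OF assms(1), of "fst x" "snd x"]
    info_decision[OF assms] assms(2) by simp

lemma active_infos_iff:
  assumes "h \<in> info G i" "x \<in> h"
  shows "h \<in> active_infos G i \<longleftrightarrow> free i (snd x)"
  using assms options_avail[OF assms] options_card by (simp add: active_infos_def)

lemma active_after_iff:
  assumes h: "h \<in> info G i" "x \<in> h" and s: "s \<in> strats_at G i h" and t: "t \<in> opps_at G i h"
  shows "(\<exists>h'\<in>active_infos G i. info_prec h h' \<and> info_prec h' {zeta G i s t}) \<longleftrightarrow>
    (\<exists>k. length (snd x) < k \<and> k < horizon G \<and> free i (snd (path i s t k)))"
proof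
  have so: "s \<in> strategies G i" using s by (simp add: strats_at_def)
  have to: "t \<in> opponents G i" using opps_atD[OF t] .
  {
    assume "\<exists>h'\<in>active_infos G i. info_prec h h' \<and> info_prec h' {zeta G i s t}"
    then obtain h' where h': "h' \<in> active_infos G i" "info_prec h h'" "info_prec h' {zeta G i s t}" by blast
    have i': "h' \<in> info G i" using h'(1) by (simp add: active_infos_def)
    obtain k where k: "k < horizon G" "path i s t k \<in> h'" using info_prec_zeta[OF i'] h'(3) by blast
    obtain j where j: "j < k" "path i s t j \<in> h" using info_prec_path[OF h(1) i' h'(2) k(2) so to] by blast
    have "length (snd x) = j" using length_info[OF h(1,2) j(2)] by simp
    moreover have "free i (snd (path i s t k))" using active_infos_iff[OF i' k(2)] h'(1) by simp
    ultimately show "\<exists>k. length (snd x) < k \<and> k < horizon G \<and> free i (snd (path i s t k))"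
      using j(1) k(1) by blast
  }
  {
    assume "\<exists>k. length (snd x) < k \<and> k < horizon G \<and> free i (snd (path i s t k))"
    then obtain k where k: "length (snd x) < k" "k < horizon G" "free i (snd (path i s t k))" by blast
    let ?h' = "info_of G i (path i s t k)"
    have d: "path i s t k \<in> decision_hists G" using path_decision[OF to so k(2)] .
    have h': "?h' \<in> info G i" "path i s t k \<in> ?h'" using info_of_mem[OF d] by simp_all
    have "path i s t (length (snd x)) \<in> h" using path_hits[OF h(1) s t h(2)] .
    moreover have "hist_prec (path i s t (length (snd x))) (path i s t k)"
    proof -
      have "snd (path i s t (length (snd x))) = take (length (snd x)) (snd (path i s t k))"
        using k(1) by (simp add: take_path)
      then have "prefix (snd (path i s t (length (snd x)))) (snd (path i s t k))" by (simp add: take_is_prefix)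
      moreover have "snd (path i s t (length (snd x))) \<noteq> snd (path i s t k)"
        using k(1) by (metis length_path less_irrefl)
      ultimately show ?thesis by (simp add: hist_prec_def strict_prefix_def)
    qed
    ultimately have "info_prec h ?h'" using h'(2) unfolding info_prec_def by blast
    moreover have "info_prec ?h' {zeta G i s t}" using info_prec_zeta[OF h'(1)] h'(2) k(2) by blast
    moreover have "?h' \<in> active_infos G i" using active_infos_iff[OF h'] k(3) by simp
    ultimately show "\<exists>h'\<in>active_infos G i. info_prec h h' \<and> info_prec h' {zeta G i s t}" by blast
  }
qed

lemma ending_opps_iff:
  assumes "h \<in> info G i" "x \<in> h"
  shows "t \<in> ending_opps G i h a \<longleftrightarrow> t \<in> opps_at G i h \<and>
    (\<forall>s\<in>strats_choosing G i h a. \<forall>k. length (snd x) < k \<longrightarrow> k < horizon G \<longrightarrow>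
       \<not> free i (snd (path i s t k)))"
  using active_after_iff[OF assms] strats_choosingD(2)[of _ i h a]
  unfolding ending_opps_def terminals_after_def by blast

text \<open>While the agent is not free, every strategy has to play the same dummy action, so
  strategies with equal choice at \<open>h\<close> cannot separate. Whether \<open>t\<close> ends
  her activity can thus be tested with a single strategy.\<close>

lemma unfree_same_path:
  assumes h: "h \<in> info G i" "x \<in> h" and s: "s \<in> strats_choosing G i h a"
    and s': "s' \<in> strats_choosing G i h a" and t: "t \<in> opps_at G i h"
    and unfree: "\<And>k. length (snd x) < k \<Longrightarrow> k < horizon G \<Longrightarrow> \<not> free i (snd (path i s t k))"
  shows "k \<le> horizon G \<Longrightarrow> path i s' t k = path i s t k"
proof (induction k)
  case 0
  then show ?case by (simp add: path_def)
next
  case (Suc k)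
  let ?n = "length (snd x)"
  note sD = strats_choosingD[OF s] and s'D = strats_choosingD[OF s']
  have to: "t \<in> opponents G i" using opps_atD[OF t] .
  have hit: "path i s t ?n \<in> h" "path i s' t ?n \<in> h"
    using path_hits[OF h(1) _ t h(2)] sD(2) s'D(2) by blast+
  have k: "k < horizon G" using Suc by simp
  have IH: "path i s' t k = path i s t k" using Suc by simp
  have d: "path i s t k \<in> decision_hists G" using path_decision[OF to sD(1) k] .
  show ?case
  proof (cases "Suc k \<le> ?n")
    case True
    then show ?thesis using path_unique[OF h(1) hit(2) hit(1)] by simp
  next
    case False
    have "the (s' (info_of G i (path i s t k))) = the (s (info_of G i (path i s t k)))"
    proof (cases "k = ?n")
      case True
      then have "info_of G i (path i s t k) = h" using info_of_eq[OF h(1) hit(1)] by simp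
      then show ?thesis using sD(3) s'D(3) by simp
    next
      case neq: False
      have nf: "\<not> free i (snd (path i s t k))" using unfree[of k] neq False k by simp
      have "the (f (info_of G i (path i s t k))) \<in> {last (snd (path i s t k)) i}"
        if f: "f \<in> strategies G i" "path i f t k = path i s t k" for f
      proof -
        have "f (info_of G i (path i s t k)) \<noteq> None" using path_defined[OF to f(1) k] f(2) by simp
        then obtain b where b: "f (info_of G i (path i s t k)) = Some b" by blast
        then have "b \<in> avail G i (info_of G i (path i s t k))" using f(1) by (simp add: strategies_def)
        then show ?thesis
          using b options_avail[OF info_of_mem[OF d]] option_unfree[OF nf] by simp
      qed
      then show ?thesis using sD(1) s'D(1) IH by fastforce
    qed
    then show ?thesis using IH unfolding path_Suc by (simp add: fun_eq_iff)
  qed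
qed

lemma copy_mimics:
  assumes h: "h \<in> info G i" "x \<in> h" and s: "s \<in> strats_at G i h" and S: "S \<subseteq> opps_at G i h"
    and a: "a \<in> avail G i h" and free: "free i (snd x)"
  shows "mimics G i h S (copy s i h a) s"
  unfolding mimics_def
proof (intro ballI impI, elim conjE)
  fix t k h1 h2
  let ?s' = "copy s i h a"
  assume tS: "t \<in> S" and k: "k \<in> first_active G i h (the (?s' h))"
    and h1: "h1 \<in> info G i" and h2: "h2 \<in> info G i"
    and kh1: "k = h1 \<or> info_prec k h1" and z1: "info_prec h1 {zeta G i ?s' t}"
    and z2: "info_prec h2 {zeta G i s t}" and st: "\<forall>x\<in>h1. \<forall>y\<in>h2. stage x = stage y"
  have t: "t \<in> opps_at G i h" using S tS by blast
  have to: "t \<in> opponents G i" using opps_atD[OF t] .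
  have so: "s \<in> strategies G i" using s by (simp add: strats_at_def)
  have so': "?s' \<in> strategies G i" using copy_strategy[OF h(1) a] .
  obtain k1 where k1: "k1 < horizon G" "path i ?s' t k1 \<in> h1" using info_prec_zeta[OF h1] z1 by blast
  obtain k2 where k2: "k2 < horizon G" "path i s t k2 \<in> h2" using info_prec_zeta[OF h2] z2 by blast
  have eq: "k2 = k1" using st k1(2) k2(2) by (force simp: stage_def)
  have kact: "k \<in> active_infos G i" "info_prec h k" using k by (simp_all add: first_active_def)
  have kinf: "k \<in> info G i" using kact(1) by (simp add: active_infos_def)
  \<comment> \<open>The stage at which the run of the copy passes the first active set
    \<open>k\<close>. The agent is free there, so from \<open>k0\<close> on the copy follows
    \<open>s\<close>.\<close>
  obtain k0 where k0: "k0 \<le> k1" "path i ?s' t k0 \<in> k"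
    using kh1 k1(2) info_prec_path[OF kinf h1 _ k1(2) so' to] by (metis less_imp_le order.refl)
  have fr: "free i (snd (path i ?s' t k0))" using active_infos_iff[OF kinf k0(2)] kact(1) by simp
  obtain n where n: "n < k0" "path i ?s' t n \<in> h"
    using info_prec_path[OF h(1) kinf kact(2) k0(2) so' to] by blast
  have "length (snd x) = n" using length_info[OF h n(2)] by simp
  then have "(snd (path i ?s' t (horizon G)) ! k1) i = (snd (path i s t (horizon G)) ! k1) i"
    using copy_follows[OF h s t a free _ k0(1) k1(1) fr] n(1) by simp
  then have "the (?s' (info_of G i (path i ?s' t k1))) = the (s (info_of G i (path i s t k1)))"
    using path_nth_own[OF to so' k1(1) order.refl] path_nth_own[OF to so k1(1) order.refl]
      path_infoset[OF to so' k1(1), of i] path_infoset[OF to so k1(1), of i] by simp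
  moreover have "?s' (info_of G i (path i ?s' t k1)) \<noteq> None" "s (info_of G i (path i s t k1)) \<noteq> None"
    using path_defined[OF to so' k1(1)] path_defined[OF to so k1(1)] by simp_all
  moreover have "info_of G i (path i ?s' t k1) = h1" "info_of G i (path i s t k1) = h2"
    using info_of_eq[OF h1 k1(2)] info_of_eq[OF h2] k2(2) eq by simp_all
  ultimately show "?s' h1 = s h2" by (metis option.expand)
qed

section \<open>The object finally obtained\<close>

definition final :: "'i \<Rightarrow> ('i, 'i \<Rightarrow> 'o rel, 'a) strat \<Rightarrow> ('i, 'i \<Rightarrow> 'o rel, 'a) opp \<Rightarrow> 'i" where
  "final i s t = target (last (snd (zeta G i s t)) i)"

lemma fst_zeta: "fst (zeta G i s t) = fst t"
  by (simp add: zeta_path)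

lemma final_unfree:
  assumes h: "h \<in> info G i" "x \<in> h" and s: "s \<in> strats_choosing G i h a" and t: "t \<in> opps_at G i h"
    and unfree: "\<And>k. length (snd x) < k \<Longrightarrow> k < horizon G \<Longrightarrow> \<not> free i (snd (path i s t k))"
  shows "final i s t = target a"
proof -
  let ?n = "length (snd x)" and ?X = "snd (path i s t (horizon G))"
  note sD = strats_choosingD[OF s]
  have to: "t \<in> opponents G i" using opps_atD[OF t] .
  have n: "?n < horizon G" using info_decision[OF h] by (simp add: decision_hists_def)
  have hit: "path i s t ?n \<in> h" using path_hits[OF h(1) sD(2) t h(2)] .
  have "feasible ?X" using path_feasible[OF to sD(1)] by simp
  moreover have "\<not> free i (take k ?X)" if "?n < k" "k < length ?X" for k
    using unfree[of k] that by (simp add: take_path)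
  ultimately have "last ?X i = (?X ! ?n) i" using unfree_const[of ?X ?n i] n by simp
  also have "\<dots> = the (s (infoset i (fst t i) (snd (path i s t ?n))))"
    using path_nth_own[OF to sD(1) n order.refl] .
  also have "\<dots> = a"
    using path_infoset[OF to sD(1) n, of i] info_of_eq[OF h(1) hit] sD(3) by simp
  finally show ?thesis by (simp add: final_def zeta_path)
qed

lemma final_remaining:
  assumes h: "h \<in> info G i" "x \<in> h" and s: "s \<in> strats_at G i h" and t: "t \<in> opps_at G i h"
    and i: "i \<in> remaining (snd x)"
  shows "final i s t \<in> remaining (snd x)"
proof -
  let ?n = "length (snd x)" and ?X = "snd (path i s t (horizon G))"
  have so: "s \<in> strategies G i" using s by (simp add: strats_at_def)
  have to: "t \<in> opponents G i" using opps_atD[OF t] .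
  have n: "?n < horizon G" using info_decision[OF h] by (simp add: decision_hists_def)
  have hit: "path i s t ?n \<in> h" using path_hits[OF h(1) s t h(2)] .
  have "remaining (take ?n (snd x)) = remaining (take ?n (snd (path i s t ?n)))"
    by (rule obs_remaining[OF info_obs(2)[OF h hit]]) simp
  then have R: "remaining (take ?n ?X) = remaining (snd x)" using n by (simp add: take_path)
  then show ?thesis
    using target_last_remaining[OF path_feasible[OF to so order.refl], of ?n i] n i
    by (simp add: final_def zeta_path)
qed

text \<open>As \<open>t\<close> does not end her activity after \<open>a\<close>, some strategy
  choosing \<open>a\<close> is free again, and by \<open>unfree_same_path\<close> so is the copy.
  From then on its actions are those of \<open>s\<close>, including the last one, which decides the
  object.\<close>

lemma final_copy:
  assumes h: "h \<in> info G i" "x \<in> h" and s: "s \<in> strats_at G i h" and t: "t \<in> opps_at G i h"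
    and a: "a \<in> avail G i h" and free: "free i (snd x)" and ne: "t \<notin> ending_opps G i h a"
  shows "final i (copy s i h a) t = final i s t"
proof -
  let ?s' = "copy s i h a"
  have s': "?s' \<in> strats_choosing G i h a" using copy_choosing[OF h s t a] .
  have "\<exists>k. length (snd x) < k \<and> k < horizon G \<and> free i (snd (path i ?s' t k))"
  proof (rule ccontr)
    assume c: "\<not> ?thesis"
    then have "path i s'' t k = path i ?s' t k"
      if "s'' \<in> strats_choosing G i h a" "k \<le> horizon G" for s'' k
      using unfree_same_path[OF h s' that(1) t _ that(2)] by blast
    then have "t \<in> ending_opps G i h a"
      unfolding ending_opps_iff[OF h] using c t by (metis less_imp_le)
    then show False using ne by simp
  qed
  then obtain k0 where k0: "length (snd x) < k0" "k0 < horizon G" "free i (snd (path i ?s' t k0))" by blast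
  let ?X = "snd (path i s t (horizon G))" and ?Y = "snd (path i ?s' t (horizon G))"
  have "(?Y ! (horizon G - 1)) i = (?X ! (horizon G - 1)) i"
    using copy_follows[OF h s t a free k0(1) _ _ k0(3), of "horizon G - 1"] k0(2) by simp
  moreover have "?X \<noteq> []" "?Y \<noteq> []" using k0(2) by (metis length_path list.size(3) not_less_zero)+
  ultimately show ?thesis by (simp add: final_def zeta_path last_conv_nth)
qed

end

section \<open>Sincere pointing\<close>

lemma payoff_induced: "payoff (induced_game M v) i z = v i (fst z i) (alloc M (snd z) i)"
  by (simp add: induced_game_def)

lemma outcome_induced: "outcome (induced_game M v) i z = alloc M (snd z) i"
  by (simp add: induced_game_def)

locale ttc_game = pointing target Acts
  for target :: "'a \<Rightarrow> 'i::finite" and Acts +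
  fixes endow :: "'i \<Rightarrow> 'o::finite" and v :: "'i \<Rightarrow> 'o rel \<Rightarrow> 'o \<Rightarrow> real"
  assumes bij_endow: "bij endow"
    and utility: "\<And>i r. r \<in> rankings \<Longrightarrow> represents (v i r) r"
begin

abbreviation G where "G \<equiv> induced_game (ttc_mech endow) v"

sublocale ttc_rules target Acts "induced_game (ttc_mech endow) v"
  by (rule induced_rules)

definition top_choice :: "'o rel \<Rightarrow> 'i set \<Rightarrow> 'i \<Rightarrow> bool" where
  "top_choice r R j \<longleftrightarrow> j \<in> R \<and> (\<forall>k\<in>R - {j}. (endow j, endow k) \<in> r)"

lemma ex_top_choice:
  assumes r: "r \<in> rankings" and R: "R \<noteq> {}"
  shows "\<exists>j. top_choice r R j"
proof -
  \<comment> \<open>An arbitrary agent: her utility for the ranking \<open>r\<close> is used only to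
    find a favourite by maximisation.\<close>
  fix i :: 'i
  have tot: "total r" using r by (simp add: rankings_def strict_linear_order_on_def)
  obtain j where j: "j \<in> R" "\<And>k. k \<in> R \<Longrightarrow> v i r (endow k) \<le> v i r (endow j)"
    using R finite_imageI[of R "\<lambda>k. v i r (endow k)"] Max_in[of "(\<lambda>k. v i r (endow k)) ` R"]
      Max_ge[of "(\<lambda>k. v i r (endow k)) ` R"] by fastforce
  have "(endow j, endow k) \<in> r" if "k \<in> R - {j}" for k
  proof -
    have "endow j \<noteq> endow k" using that bij_endow by (auto simp: bij_def inj_def)
    then have "(endow j, endow k) \<in> r \<or> (endow k, endow j) \<in> r" using tot by (simp add: total_on_def)
    moreover have "(endow k, endow j) \<notin> r"
      using j(2)[of k] that utility[OF r, of i] by (auto simp: represents_def)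
    ultimately show ?thesis by blast
  qed
  then show ?thesis using j(1) by (auto simp: top_choice_def)
qed

lemma points_to_top_choice:
  assumes "\<theta> i \<in> rankings" "top_choice (\<theta> i) R j"
  shows "points_to endow \<theta> R i = j"
  unfolding points_to_def
proof (rule the_equality)
  show "j \<in> R \<and> (\<forall>k\<in>R - {j}. (endow j, endow k) \<in> \<theta> i)" using assms(2) by (simp add: top_choice_def)
  fix k assume k: "k \<in> R \<and> (\<forall>l\<in>R - {k}. (endow k, endow l) \<in> \<theta> i)"
  have "trans (\<theta> i)" "irrefl (\<theta> i)"
    using assms(1) by (simp_all add: rankings_def strict_linear_order_on_def)
  then show "k = j" using k assms(2) unfolding top_choice_def irrefl_def
    by (metis DiffI singletonD transD)
qed

lemma top_choice_points_to:
  assumes "\<theta> i \<in> rankings" "R \<noteq> {}"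
  shows "top_choice (\<theta> i) R (points_to endow \<theta> R i)"
  using ex_top_choice[OF assms] points_to_top_choice[of \<theta> i R] assms(1) by auto

lemma payoff_final: "payoff G i (zeta G i s t) = v i (fst t i) (endow (final i s t))"
  unfolding payoff_induced final_def fst_zeta by (simp add: ttc_mech_def)

lemma outcome_final: "outcome G i (zeta G i s t) = endow (final i s t)"
  unfolding outcome_induced final_def by (simp add: ttc_mech_def)

lemma top_choice_dominant:
  assumes h: "h \<in> info G i" "x \<in> h" and free: "free i (snd x)" and a': "a' \<in> avail G i h"
    and top: "top_choice (fst x i) (remaining (snd x)) (target a')"
  shows "locally_dominant G i h a'"
  unfolding locally_dominant_def locally_dominates_def
proof (intro conjI ballI impI)
  show "a' \<in> avail G i h" by (rule a')
  fix a S s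
  assume S: "S \<in> local_partition G i h a' a" "S \<noteq> {}" and s: "s \<in> strats_choosing G i h a"
  let ?r = "fst x i" and ?s' = "copy s i h a'"
  have r: "?r \<in> rankings"
    using info_decision[OF h] by (cases x) (simp add: decision_hists profiles_def)
  have sub: "S \<subseteq> opps_at G i h"
    using S(1) by (auto simp: local_partition_def both_end_def only_first_ends_def none_ends_def
        ending_opps_def)
  note sD = strats_choosingD[OF s]
  have s': "?s' \<in> strats_choosing G i h a'" using copy_choosing[OF h sD(2) _ a'] S(2) sub by blast
  have ranking: "fst t i = ?r" if t: "t \<in> S" for t
    using info_obs(1)[OF h path_hits[OF h(1) sD(2) subsetD[OF sub t] h(2)]] by simp
  have dominates: "Min ((\<lambda>t. payoff G i (zeta G i ?s' t)) ` S) \<ge> Max ((\<lambda>t. payoff G i (zeta G i s t)) ` S)"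
    if three: "S \<in> {both_end G i h a' a, only_first_ends G i h a' a, only_first_ends G i h a a'}"
  proof -
    \<comment> \<open>Two opponents are needed, since the worst case of the copy is compared with
      the best case of \<open>s\<close>.\<close>
    have le: "v i ?r (endow (final i s t2)) \<le> v i ?r (endow (final i ?s' t1))"
      if t: "t1 \<in> S" "t2 \<in> S" for t1 t2
    proof -
      have ts: "t1 \<in> opps_at G i h" "t2 \<in> opps_at G i h" using t sub by blast+
      show ?thesis
      proof (cases "t1 \<in> ending_opps G i h a'")
        \<comment> \<open>This covers the first two cells. The agent gets her favourite among the
          remaining objects, and whatever \<open>s\<close> gets against \<open>t2\<close> was also
          available at \<open>h\<close>.\<close>
        case True
        then have f': "final i ?s' t1 = target a'"
          using final_unfree[OF h s' ts(1)] s' unfolding ending_opps_iff[OF h] by blast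
        have "final i s t2 \<in> remaining (snd x)"
          using final_remaining[OF h sD(2) ts(2)] free by (simp add: free_def)
        then have "final i s t2 = target a' \<or> (endow (target a'), endow (final i s t2)) \<in> ?r"
          using top by (auto simp: top_choice_def)
        then show ?thesis using utility[OF r, of i] f' by (auto simp: represents_def)
      next
        case False
        \<comment> \<open>In the remaining cell \<open>s\<close> gets the target of \<open>a\<close>
          against every opponent, so \<open>t2\<close> may be replaced by \<open>t1\<close>, where
          the copy gets what \<open>s\<close> gets.\<close>
        then have "S = only_first_ends G i h a a'"
          using three t(1) by (auto simp: both_end_def only_first_ends_def)
        then have "t1 \<in> ending_opps G i h a" "t2 \<in> ending_opps G i h a"
          using t by (auto simp: only_first_ends_def)
        then have "final i s t1 = target a" "final i s t2 = target a"
          using final_unfree[OF h s ts(1)] final_unfree[OF h s ts(2)] s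
          unfolding ending_opps_iff[OF h] by blast+
        moreover have "final i ?s' t1 = final i s t1"
          using final_copy[OF h sD(2) ts(1) a' free False] .
        ultimately show ?thesis by simp
      qed
    qed
    have pay: "(\<lambda>t. payoff G i (zeta G i f t)) ` S = (\<lambda>t. v i ?r (endow (final i f t))) ` S" for f
      by (intro image_cong) (simp_all add: payoff_final ranking)
    \<comment> \<open>Finiteness is needed for the image only, and it comes from there being
      finitely many agents.\<close>
    have fin: "finite ((\<lambda>t. v i ?r (endow (final i f t))) ` S)" for f
      by (rule finite_subset[of _ "range (\<lambda>j. v i ?r (endow j))"]) auto
    show ?thesis
      unfolding pay using le S(2) fin by (auto simp: Min_ge_iff Max_le_iff)
  qed
  show "\<exists>s'\<in>strats_choosing G i h a'. mimics G i h S s' s \<and>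
      (S \<in> {both_end G i h a' a, only_first_ends G i h a' a, only_first_ends G i h a a'} \<longrightarrow>
         Min ((\<lambda>t. payoff G i (zeta G i s' t)) ` S) \<ge> Max ((\<lambda>t. payoff G i (zeta G i s t)) ` S)) \<and>
      (S = none_ends G i h a' a \<longrightarrow>
         (\<forall>t\<in>S. outcome G i (zeta G i s' t) = outcome G i (zeta G i s t)))"
  proof (intro bexI[OF _ s'] conjI impI ballI)
    show "mimics G i h S ?s' s" using copy_mimics[OF h sD(2) sub a' free] .
    show "Min ((\<lambda>t. payoff G i (zeta G i ?s' t)) ` S) \<ge> Max ((\<lambda>t. payoff G i (zeta G i s t)) ` S)"
      if "S \<in> {both_end G i h a' a, only_first_ends G i h a' a, only_first_ends G i h a a'}"
      using dominates[OF that] .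
    show "outcome G i (zeta G i ?s' t) = outcome G i (zeta G i s t)"
      if "S = none_ends G i h a' a" "t \<in> S" for t
      using final_copy[OF h sD(2) _ a' free, of t] that by (simp add: outcome_final none_ends_def)
  qed
qed

section \<open>Sincere strategies and their outcome\<close>

definition sincere_action :: "'i \<Rightarrow> ('i, 'i \<Rightarrow> 'o rel, 'a) hist set \<Rightarrow> 'a" where
  "sincere_action i h = (let x = SOME x. x \<in> h; j = points_to endow (fst x) (remaining (snd x)) i in
     if \<exists>b\<in>avail G i h. target b = j then SOME b. b \<in> avail G i h \<and> target b = j
     else SOME b. b \<in> avail G i h)"

definition sincere :: "'i \<Rightarrow> ('i, 'i \<Rightarrow> 'o rel, 'a) strat" where
  "sincere i = reduced G i (sincere_action i)"

lemma sincere_action_avail: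
  assumes "h \<in> info G i"
  shows "sincere_action i h \<in> avail G i h"
proof -
  have "avail G i h \<noteq> {}" using multistage_form assms by (simp add: multistage_form_def)
  moreover have "(SOME b. b \<in> A \<and> P b) \<in> A" if "\<exists>b\<in>A. P b" for A and P :: "'a \<Rightarrow> bool"
    using someI_ex[of "\<lambda>b. b \<in> A \<and> P b"] that by blast
  ultimately show ?thesis by (simp add: sincere_action_def Let_def some_in_eq)
qed

lemma sincere_strategy: "sincere i \<in> strategies G i"
  unfolding sincere_def using sincere_action_avail by (rule reduced_strategy)

lemma target_sincere_action:
  assumes h: "h \<in> info G i" "x \<in> h" and free: "free i (snd x)"
  shows "target (sincere_action i h) = points_to endow (fst x) (remaining (snd x)) i"
proof -
  define y where "y = (SOME y. y \<in> h)"
  have y: "y \<in> h" unfolding y_def using h(2) by (rule someI)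
  have R: "remaining (snd y) = remaining (snd x)"
    using obs_remaining[OF info_obs(2)[OF h y], of "length (snd x)"]
      obs_length[OF info_obs(2)[OF h y]] by simp
  let ?j = "points_to endow (fst x) (remaining (snd x)) i"
  have j: "points_to endow (fst y) (remaining (snd y)) i = ?j"
    using info_obs(1)[OF h y] R by (simp add: points_to_def)
  have "fst x i \<in> rankings"
    using info_decision[OF h] by (cases x) (simp add: decision_hists profiles_def)
  then have "?j \<in> remaining (snd x)"
    using top_choice_points_to[of "fst x" i "remaining (snd x)"] free
    by (auto simp: top_choice_def free_def)
  moreover obtain b where "b \<in> Acts" "target b = ?j" using two_codes by blast
  ultimately have b: "\<exists>b\<in>avail G i h. target b = ?j"
    using free options_avail[OF h] by (auto simp: options_def)
  then have "target (SOME b. b \<in> avail G i h \<and> target b = ?j) = ?j"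
    using someI_ex[of "\<lambda>b. b \<in> avail G i h \<and> target b = ?j"] by blast
  then show ?thesis using b j by (simp add: sincere_action_def Let_def flip: y_def)
qed

lemma sincere_dominant: "locally_dominant_strategy G i (sincere i)"
  unfolding locally_dominant_strategy_def
proof (intro conjI ballI)
  show "sincere i \<in> strategies G i" by (rule sincere_strategy)
  fix h assume "h \<in> active_infos_under G i (sincere i)"
  then have act: "h \<in> active_infos G i" and at: "sincere i \<in> strats_at G i h"
    by (simp_all add: active_infos_under_def)
  have h: "h \<in> info G i" using act by (simp add: active_infos_def)
  obtain t k where t: "t \<in> opponents G i" "k < horizon G" "path i (sincere i) t k \<in> h"
    using at strats_at_iff[OF h] by blast
  let ?x = "path i (sincere i) t k"
  have free: "free i (snd ?x)" using active_infos_iff[OF h t(3)] act by simp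
  have "sincere i h \<noteq> None"
    using path_defined[OF t(1) sincere_strategy t(2)] info_of_eq[OF h t(3)] by simp
  then have "sincere i h = Some (sincere_action i h)" unfolding sincere_def by (intro reduced_eq) blast
  moreover have "locally_dominant G i h (sincere_action i h)"
  proof (rule top_choice_dominant[OF h t(3) free sincere_action_avail[OF h]])
    have "fst ?x i \<in> rankings"
      using info_decision[OF h t(3)] by (cases ?x) (simp add: decision_hists profiles_def)
    then show "top_choice (fst ?x i) (remaining (snd ?x)) (target (sincere_action i h))"
      unfolding target_sincere_action[OF h t(3) free] using free
      by (intro top_choice_points_to) (auto simp: free_def)
  qed
  ultimately show "locally_dominant G i h (the (sincere i h))" by simp
qed

text \<open>TTC lets everyone point anew in each round, whereas here pointers are kept. By induction
  on rounds, a kept pointer of an unassigned agent is always the one that TTC prescribes, so the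
  same cycles are removed.\<close>

lemma sincere_ttc:
  assumes \<theta>: "\<theta> \<in> profiles"
  shows "alloc (ttc_mech endow) (snd (play G sincere \<theta> (horizon G))) = ttc endow \<theta>"
proof
  fix i
  define A where "A = snd (play G sincere \<theta> (horizon G))"
  let ?R = "\<lambda>k. remaining (take k A)"
  have nat: "\<theta> \<in> nature G" using \<theta> nature by simp
  have rk: "\<theta> j \<in> rankings" for j using \<theta> by (simp add: profiles_def)
  have len: "length A = horizon G" by (simp add: A_def)
  have feas: "feasible A"
    using play_mem[OF sincere_strategy nat order.refl] by (cases "play G sincere \<theta> (horizon G)") (auto simp: A_def hists)
  have pointed: "target ((A ! k) j) = points_to endow \<theta> (?R k) j"
    if k: "k < horizon G" and fr: "free j (take k A)" for k j
  proof -
    let ?x = "play G sincere \<theta> k"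
    have tk: "take k A = snd ?x" using k by (simp add: A_def take_play)
    have d: "?x \<in> decision_hists G" using play_decision[OF sincere_strategy nat k] .
    have "(A ! k) j = the (sincere j (info_of G j ?x))" using k by (simp add: A_def nth_play)
    also have "\<dots> = sincere_action j (info_of G j ?x)"
      by (rule reduced_play[OF sincere_strategy nat k sincere_def])
    finally show ?thesis
      using target_sincere_action[OF info_of_mem[OF d]] fr tk by simp
  qed
  have sincere: "target ((A ! k) j) = points_to endow \<theta> (?R k) j"
    if "k < horizon G" "j \<in> ?R k" for k j
    using that
  proof (induction k)
    case 0
    then show ?case using pointed[of 0 j] by (simp add: free_def)
  next
    case (Suc k)
    show ?case
    proof (cases "free j (take (Suc k) A)")
      case True
      then show ?thesis using pointed[OF Suc(2)] by simp
    next
      case False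
      have mono: "?R (Suc k) \<subseteq> ?R k" by (simp add: remaining_take_mono)
      let ?j = "target ((A ! k) j)"
      have "?j = points_to endow \<theta> (?R k) j" using Suc mono by auto
      then have "top_choice (\<theta> j) (?R k) ?j"
        using top_choice_points_to[of \<theta> j "?R k", OF rk] Suc(3) mono by auto
      moreover have "?j \<in> ?R (Suc k)"
        using False Suc(2,3) last_take[of "Suc k" A] len by (auto simp: free_def)
      \<comment> \<open>A favourite in the larger set that is still present is the favourite in the
        subset.\<close>
      ultimately have "top_choice (\<theta> j) (?R (Suc k)) ?j"
        using mono by (auto simp: top_choice_def)
      then have "points_to endow \<theta> (?R (Suc k)) j = ?j" using points_to_top_choice[of \<theta> j, OF rk] by simp
      then show ?thesis using unfree_nth[OF feas _ _ False] Suc(2) len by simp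
    qed
  qed
  have un: "?R k = unassigned endow \<theta> k" if "k \<le> horizon G" for k
    using that
  proof (induction k)
    case (Suc k)
    have p: "\<forall>j. (A ! k) j \<in> options j (take k A)" using feasible_nth[OF feas] Suc len by simp
    have "cyc (target \<circ> A ! k) (?R k) = cyc (points_to endow \<theta> (?R k)) (?R k)"
      using sincere[of k] Suc(2) by (intro cyc_cong[OF pointers_closed[OF p]]) simp
    then show ?case using Suc remaining_take_Suc[of k A] len by (simp add: in_cycle_eq_cyc)
  qed simp
  let ?P = "\<lambda>k. i \<in> in_cycle endow \<theta> (unassigned endow \<theta> k)"
  have "unassigned endow \<theta> (horizon G) = {}"
    using un[of "horizon G"] remaining_empty[OF feas] len horizon by simp
  moreover have "\<exists>k<m. ?P k" if "i \<notin> unassigned endow \<theta> m" for m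
    using that by (induction m) (auto simp: less_Suc_eq)
  ultimately obtain m where m: "m < horizon G" "?P m" by blast
  define k where "k = (LEAST k. ?P k)"
  have Pk: "?P k" unfolding k_def using m(2) by (rule LeastI)
  have k: "k < horizon G" using Least_le[of ?P m] m by (simp add: k_def)
  have iR: "i \<in> ?R k" using Pk un[of k] k by (simp add: in_cycle_def)
  have "i \<notin> ?R (Suc k)" using Pk un[of "Suc k"] k by simp
  \<comment> \<open>After leaving in round \<open>k\<close> she only repeats, so her final pointer
    is the one that closed her cycle.\<close>
  then have "\<not> free i (take l A)" if "k < l" for l
    using remaining_take_mono[of "Suc k" l A] that by (auto simp: free_def)
  then have "last A i = (A ! k) i" using unfree_const[OF feas] k len by simp
  then have "endow (target (last A i)) = endow (points_to endow \<theta> (unassigned endow \<theta> k) i)"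
    using sincere[OF k iR] un[of k] k by simp
  then show "alloc (ttc_mech endow) (snd (play G sincere \<theta> (horizon G))) i = ttc endow \<theta> i"
    unfolding A_def[symmetric] by (simp add: ttc_mech_def ttc_def k_def Let_def)
qed

end

theorem theorem4:
  fixes endow :: "'i::finite \<Rightarrow> 'o::finite"
  assumes "bij endow"
  shows "\<exists>M :: ('i, nat, 'o) mechanism. is_mechanism M \<and>
    (\<forall>v :: 'i \<Rightarrow> 'o rel \<Rightarrow> 'o \<Rightarrow> real.
       (\<forall>i. \<forall>r\<in>rankings. represents (v i r) r) \<longrightarrow>
       locally_strategy_proof (induced_game M v) \<and>
       (\<exists>s. (\<forall>i. locally_dominant_strategy (induced_game M v) i (s i)) \<and>
            (\<forall>\<theta>\<in>profiles.
               alloc M (snd (play (induced_game M v) s \<theta> (rounds M))) = ttc endow \<theta>)))"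
proof -
  obtain f :: "'i \<Rightarrow> nat" where f: "inj f" using finite_imp_inj_to_nat_seg[OF finite_UNIV] by blast
  \<comment> \<open>Actions have to be natural numbers: agent \<open>j\<close> gets the two codes
    \<open>2 * f j\<close> and \<open>2 * f j + 1\<close>, which halving maps back to
    \<open>f j\<close>.\<close>
  define target where "target n = inv f (n div 2)" for n
  define Acts where "Acts = range (\<lambda>j. 2 * f j) \<union> range (\<lambda>j. 2 * f j + 1)"
  interpret pointing target Acts
  proof
    show "finite Acts" by (simp add: Acts_def)
    show "\<exists>a\<in>Acts. \<exists>b\<in>Acts. a \<noteq> b \<and> target a = j \<and> target b = j" for j
      using f by (intro bexI[of _ "2 * f j"] bexI[of _ "2 * f j + 1"]) (auto simp: target_def Acts_def)
  qed
  let ?M = "ttc_mech endow"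
  have "locally_strategy_proof (induced_game ?M v) \<and>
      (\<exists>s. (\<forall>i. locally_dominant_strategy (induced_game ?M v) i (s i)) \<and>
        (\<forall>\<theta>\<in>profiles. alloc ?M (snd (play (induced_game ?M v) s \<theta> (rounds ?M))) = ttc endow \<theta>))"
    if "\<forall>i. \<forall>r\<in>rankings. represents (v i r) r" for v
  proof -
    interpret ttc_game target Acts endow v
      using assms that by unfold_locales auto
    have "rounds ?M = horizon (induced_game ?M v)" by (simp add: induced_game_def mech_form_def)
    then show ?thesis
      using sincere_dominant sincere_ttc unfolding locally_strategy_proof_def by metis
  qed
  then show ?thesis using ttc_mech_is_mechanism[OF assms] by blast
qed

end
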